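(* There exists a deterministic online algorithm for the online facility location problem with two-sided delay (where all waiting costs are equal to waiting times) that is $3.869$-competitive, i.e., on every instance its total cost is at most $3.869$ times the total cost of an optimal offline solution of that instance.
   Context: Online facility location with two-sided delay. Let $(\mathcal{X},\mathrm{dist})$ be a metric space, $\mathcal{Y}\subseteq\mathcal{X}$ a set of potential facility locations, and $\mathrm{open}:\mathcal{Y}\to\mathbb{R}_{\ge 0}\cup\{\infty\}$ opening costs. Clients $1,\dots,n$ arrive over time; client $j$ appears at time $t_j$ at a point $x_j\in\mathcal{X}$, and $n$ is not known in advance to the online algorithm, which at each time knows only the clients that have arrived so far. At any time the algorithm may open a facility at any $y\in\mathcal{Y}$, paying $\mathrm{open}(y)$; several facilities may be opened at the same location at different times, and once opened a facility stays open forever. Each client $j$ must eventually be connected, at some time $t^c_j\ge t_j$, to a facility at location $y$ that was opened at a time $\tau\le t^c_j$; this connection costs $\mathrm{dist}(x_j,y)$ (connection cost) plus the client-side waiting cost $t^c_j-t_j$ plus the facility-side waiting cost $t^c_j-\tau$. The total cost is the sum of all opening, connection and waiting costs, and the goal is to minimize it. An online algorithm is $c$-competitive if on every instance its total cost is at most $c$ times the optimal offline total cost. *)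

theory Defs
  imports "HOL-Analysis.Analysis"
begin

text \<open>
  The data known to an algorithm in advance. Only the values of \<open>open_cost\<close> on \<open>sites\<close> matter.
\<close>

record 'a environment =
  points :: "'a set"
  metric :: "'a \<Rightarrow> 'a \<Rightarrow> real"
  sites :: "'a set"
  open_cost :: "'a \<Rightarrow> ennreal"

definition environment :: "'a environment \<Rightarrow> bool" where
  "environment E \<longleftrightarrow>
     Metric_space (points E) (metric E) \<and> sites E \<subseteq> points E \<and> sites E \<noteq> {}"

type_synonym 'a client = "real \<times> 'a"

abbreviation arrival :: "'a client \<Rightarrow> real" where "arrival \<equiv> fst"
abbreviation position :: "'a client \<Rightarrow> 'a" where "position \<equiv> snd"

text \<open>Clients are listed in order of arrival and numbered from 0; simultaneous arrivals are allowed.\<close>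

definition client_sequence :: "'a environment \<Rightarrow> 'a client list \<Rightarrow> bool" where
  "client_sequence E cs \<longleftrightarrow>
     sorted (map arrival cs) \<and> (\<forall>c \<in> set cs. position c \<in> points E)"

text \<open>
  A facility is identified by its location and its opening time, so one location can carry several
  facilities opened at different times. The entries of \<open>conn_time\<close> and \<open>conn_fac\<close> are meaningful
  only at the indices of actual clients.
\<close>

type_synonym 'a facility = "'a \<times> real"

abbreviation location :: "'a facility \<Rightarrow> 'a" where "location \<equiv> fst"
abbreviation opening_time :: "'a facility \<Rightarrow> real" where "opening_time \<equiv> snd"

record 'a solution =
  opened :: "'a facility set"
  conn_time :: "nat \<Rightarrow> real"
  conn_fac :: "nat \<Rightarrow> 'a facility"

definition feasible :: "'a environment \<Rightarrow> 'a client list \<Rightarrow> 'a solution \<Rightarrow> bool" where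
  "feasible E cs S \<longleftrightarrow>
     finite (opened S) \<and>
     (\<forall>f \<in> opened S. location f \<in> sites E) \<and>
     (\<forall>j < length cs.
        conn_fac S j \<in> opened S \<and>
        opening_time (conn_fac S j) \<le> conn_time S j \<and>
        arrival (cs ! j) \<le> conn_time S j)"

definition client_cost :: "'a environment \<Rightarrow> 'a client list \<Rightarrow> 'a solution \<Rightarrow> nat \<Rightarrow> real" where
  "client_cost E cs S j =
     metric E (position (cs ! j)) (location (conn_fac S j))
     + (conn_time S j - arrival (cs ! j))
     + (conn_time S j - opening_time (conn_fac S j))"

definition total_cost :: "'a environment \<Rightarrow> 'a client list \<Rightarrow> 'a solution \<Rightarrow> ennreal" where
  "total_cost E cs S =
     (\<Sum>f \<in> opened S. open_cost E (location f))
     + (\<Sum>j < length cs. ennreal (client_cost E cs S j))"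

definition optimal :: "'a environment \<Rightarrow> 'a client list \<Rightarrow> 'a solution \<Rightarrow> bool" where
  "optimal E cs S \<longleftrightarrow>
     feasible E cs S \<and> (\<forall>S'. feasible E cs S' \<longrightarrow> total_cost E cs S \<le> total_cost E cs S')"

text \<open>
  A deterministic algorithm is a function from the environment and the client sequence to a
  solution. It is online if it is non-anticipating: everything it does up to time \<open>T\<close> is determined
  by the clients that have arrived up to time \<open>T\<close>. As the two sequences compared may differ
  arbitrarily after \<open>T\<close>, also in length, neither future clients nor their number can be used.
\<close>

definition arrived :: "real \<Rightarrow> 'a client list \<Rightarrow> 'a client list" where
  "arrived T cs = filter (\<lambda>c. arrival c \<le> T) cs"

definition openings_until :: "real \<Rightarrow> 'a solution \<Rightarrow> 'a facility set" where
  "openings_until T S = {f \<in> opened S. opening_time f \<le> T}"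

definition connections_until ::
  "real \<Rightarrow> 'a client list \<Rightarrow> 'a solution \<Rightarrow> (nat \<times> real \<times> 'a facility) set" where
  "connections_until T cs S =
     {(j, conn_time S j, conn_fac S j) | j. j < length cs \<and> conn_time S j \<le> T}"

type_synonym 'a algorithm = "'a environment \<Rightarrow> 'a client list \<Rightarrow> 'a solution"

definition online_algorithm :: "'a algorithm \<Rightarrow> bool" where
  "online_algorithm A \<longleftrightarrow>
     (\<forall>E. environment E \<longrightarrow>
        (\<forall>cs. client_sequence E cs \<longrightarrow> feasible E cs (A E cs)) \<and>
        (\<forall>cs cs' T. client_sequence E cs \<longrightarrow> client_sequence E cs' \<longrightarrow>
           arrived T cs = arrived T cs' \<longrightarrow>
           openings_until T (A E cs) = openings_until T (A E cs') \<and>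
           connections_until T cs (A E cs) = connections_until T cs' (A E cs')))"

text \<open>
  The comparison is with an optimal solution, not with the infimum of the costs of all solutions.
  The two agree whenever the infimum is attained, e.g. for finite \<open>sites\<close>. If it is not attained,
  the infimum can be 0 although every solution has positive cost: take one client and sites
  at distance and opening cost \<open>1 / k\<close> for all \<open>k \<ge> 1\<close>.
\<close>

definition competitive :: "real \<Rightarrow> 'a algorithm \<Rightarrow> bool" where
  "competitive c A \<longleftrightarrow>
     (\<forall>E cs S. environment E \<longrightarrow> client_sequence E cs \<longrightarrow> optimal E cs S \<longrightarrow>
        total_cost E cs (A E cs) \<le> ennreal c * total_cost E cs S)"

end

theory Submission imports Defs begin

text \<open>
  A client that has waited for time \<open>a\<close> has a budget of \<open>\<gamma> a\<close>, where \<open>\<gamma> = 3.86\<close>. It is connected to an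
  open facility as soon as its budget covers the cost of this connection, and it offers to every site
  what its budget would leave after paying for a connection to a facility opened there now. A facility is
  opened as soon as the offers cover the opening cost. If the infimum of the times at which some site
  is covered is not attained, a site is opened that is covered up to a small error. The
  errors are summable, and each of them is negligible compared with a positive lower bound on the
  optimum that the position of a waiting client implies.

  The total cost is at most \<open>\<gamma>\<close> times the total waiting time plus the errors. The waiting times are
  compared with each star of an optimal solution separately, as in the dual fitting analysis of
  Jain, Mahdian and Saberi. In a star with opening cost \<open>f\<close>, the offers never exceed \<open>f\<close>, and by the
  triangle inequality a client cannot remain unconnected much longer than another client of the
  star. Sort the clients by connection time, cut them into 100 blocks of equal size (after
  replicating every client), and add the inequalities with weights that are piecewise linear in the
  position of the client. The weights are an approximate solution of the dual of the factor-revealing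
  linear program, and they yield the factor 3.8688.
\<close>

section \<open>Weighted combination of the constraints of a star\<close>

text \<open>Once its own waiting is paid for, a client keeps \<open>p\<close> = \<gamma> - 1 per
  unit of time, and this rate drives offers and connections. The facility-side waiting grows while a
  client waits, so the inequality between two clients of a star controls only \<open>p - 1\<close>
  times the difference of their connection times. Measured from the opening time of the facility of
  the star, an arrival at time t costs the optimum at least \<bar>t\<bar> in waiting, whichever of
  the two events is first. In the dual, the coefficient of an arrival time therefore need not
  vanish; it only has to lie between -\<lambda> and \<lambda>. A general dual solution has a
  multiplier for every pair of clients. Taking these multipliers as products of a weight on early
  clients and a weight on late ones leaves only functions of the position in the connection order,
  and these can be tabulated once for stars of all sizes. Online consistency comes from planning to
  the end as if nobody else would arrive, and revoking at each arrival exactly the connections that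
  were not made before it.\<close>

lemma weak_duality:
  fixes T t D z u v :: "nat \<Rightarrow> real" and R :: "nat \<Rightarrow> nat" and p g lam F :: real
  defines "Z \<equiv> \<lambda>m. \<Sum>i | i \<le> m \<and> m < R i. z i"
  assumes block: "\<And>m. m < n \<Longrightarrow>
      p * real (R m - m) * T m - (\<Sum>i=m..<R m. p * t i + D i) \<le> F"
    and pair: "\<And>i j. i < j \<Longrightarrow> j < n \<Longrightarrow> (p - 1) * (T j - T i) \<le> D i + D j + p * (t j - t i)"
    and tT: "\<And>m. m < n \<Longrightarrow> t m \<le> T m" and D: "\<And>m. m < n \<Longrightarrow> 0 \<le> D m" and F: "0 \<le> F"
    and z: "\<And>m. m < n \<Longrightarrow> 0 \<le> z m" and u: "\<And>m. m < n \<Longrightarrow> 0 \<le> u m"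
    and v: "\<And>m. m < n \<Longrightarrow> 0 \<le> v m"
    and R: "\<And>m. m < n \<Longrightarrow> R m \<le> n"
    and sep: "\<And>i j. i < n \<Longrightarrow> j < n \<Longrightarrow> u i \<noteq> 0 \<Longrightarrow> v j \<noteq> 0 \<Longrightarrow> i < j"
    and p: "1 < p"
    and T_coeff: "\<And>m. m < n \<Longrightarrow> g \<le> p * real (R m - m) * z m + (p - 1) * (v m - u m)"
    and t_coeff: "\<And>m. m < n \<Longrightarrow> p * Z m - p * real (R m - m) * z m + v m \<le> lam"
      "\<And>m. m < n \<Longrightarrow> - lam \<le> p * Z m - p * real (R m - m) * z m - u m"
    and D_coeff: "\<And>m. m < n \<Longrightarrow> Z m + u m + v m \<le> lam"
    and F_coeff: "sum z {..<n} \<le> lam"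
    and uv: "sum v {..<n} \<le> sum u {..<n}"
  shows "g * (\<Sum>m<n. T m - t m) \<le> lam * (F + (\<Sum>m<n. D m + \<bar>t m\<bar>))"
proof -
  define q where "q = (\<lambda>m. p * t m + D m)"
  define w where "w = (\<lambda>m. D m - p * t m)"
  \<comment> \<open>The pair multipliers will be the products \<open>u' i * v j\<close>, which
    requires marginals of equal mass. All conditions on the coefficients survive a decrease of
    \<open>u\<close> to smaller nonnegative values, so \<open>u\<close> is scaled down to the mass
    of \<open>v\<close>.\<close>
  define s where "s = sum v {..<n} / sum u {..<n}"
  define u' where "u' = (\<lambda>m. s * u m)"
  have su0: "0 \<le> sum u {..<n}" and sv0: "0 \<le> sum v {..<n}"
    using u v by (auto intro!: sum_nonneg)
  have s: "0 \<le> s" "s \<le> 1"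
    unfolding s_def using su0 sv0 uv by (auto simp: divide_le_eq_1)
  have su': "sum u' {..<n} = sum v {..<n}"
  proof -
    have "sum u' {..<n} = s * sum u {..<n}"
      unfolding u'_def by (rule sum_distrib_left[symmetric])
    then show ?thesis using su0 sv0 uv by (cases "sum u {..<n} = 0") (auto simp: s_def)
  qed
  have u'0: "0 \<le> u' m" and u'u: "u' m \<le> u m" if "m < n" for m
    using u[OF that] s by (auto simp: u'_def intro: mult_left_le_one_le)
  have Zq: "(\<Sum>m<n. z m * (\<Sum>i=m..<R m. q i)) = (\<Sum>i<n. q i * Z i)"
  proof -
    have "(\<Sum>m<n. z m * (\<Sum>i=m..<R m. q i)) = (\<Sum>m<n. \<Sum>i<n. if m \<le> i \<and> i < R m then z m * q i else 0)"
    proof (rule sum.cong[OF refl])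
      fix m assume "m \<in> {..<n}"
      then have "{m..<R m} = {i \<in> {..<n}. m \<le> i \<and> i < R m}" using R[of m] by auto
      then have "(\<Sum>i=m..<R m. q i) = (\<Sum>i<n. if m \<le> i \<and> i < R m then q i else 0)"
        by (simp only: sum.inter_filter[OF finite_lessThan])
      then show "z m * (\<Sum>i=m..<R m. q i) = (\<Sum>i<n. if m \<le> i \<and> i < R m then z m * q i else 0)"
        by (simp add: sum_distrib_left if_distrib cong: if_cong)
    qed
    also have "\<dots> = (\<Sum>i<n. \<Sum>m<n. if m \<le> i \<and> i < R m then z m * q i else 0)"
      by (rule sum.swap)
    also have "\<dots> = (\<Sum>i<n. q i * Z i)"
    proof (rule sum.cong[OF refl])
      fix i assume i: "i \<in> {..<n}"
      have "{m. m \<le> i \<and> i < R m} = {m \<in> {..<n}. m \<le> i \<and> i < R m}" using i by auto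
      then have "Z i = (\<Sum>m<n. if m \<le> i \<and> i < R m then z m else 0)"
        unfolding Z_def by (simp only: sum.inter_filter[OF finite_lessThan])
      then show "(\<Sum>m<n. if m \<le> i \<and> i < R m then z m * q i else 0) = q i * Z i"
        by (simp add: sum_distrib_left if_distrib mult.commute cong: if_cong)
    qed
    finally show ?thesis .
  qed
  have "(\<Sum>m<n. z m * (p * real (R m - m) * T m - (\<Sum>i=m..<R m. q i))) \<le> (\<Sum>m<n. z m * F)"
    by (intro sum_mono mult_left_mono) (use block z in \<open>auto simp: q_def\<close>)
  also have "\<dots> \<le> lam * F"
    using F_coeff F by (simp add: mult_right_mono flip: sum_distrib_right)
  finally have A: "(\<Sum>m<n. p * real (R m - m) * z m * T m - q m * Z m) \<le> lam * F"
    by (simp add: sum_subtractf right_diff_distrib Zq mult_ac)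
  \<comment> \<open>The inequality \<open>pair\<close> is summed over all i and j with weight
    \<open>u' i * v j\<close>; by \<open>sep\<close>, i < j wherever this weight is nonzero. Both
    double sums factor, and the common mass cancels.\<close>
  have B: "(\<Sum>j<n. v j * ((p - 1) * T j - q j)) \<le> (\<Sum>i<n. u' i * ((p - 1) * T i + w i))"
  proof (cases "sum v {..<n} = 0")
    case True
    then have "v j = 0" "u' j = 0" if "j < n" for j
      using that v u'0 su' sum_nonneg_eq_0_iff[of "{..<n}" v] sum_nonneg_eq_0_iff[of "{..<n}" u'] by auto
    then show ?thesis by simp
  next
    case False
    then have V: "0 < sum v {..<n}" using sv0 by simp
    have "(\<Sum>i<n. \<Sum>j<n. u' i * v j * ((p - 1) * T j - q j))
        \<le> (\<Sum>i<n. \<Sum>j<n. u' i * v j * ((p - 1) * T i + w i))"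
    proof (intro sum_mono)
      fix i j assume ij: "i \<in> {..<n}" "j \<in> {..<n}"
      show "u' i * v j * ((p - 1) * T j - q j) \<le> u' i * v j * ((p - 1) * T i + w i)"
      proof (cases "u i = 0 \<or> v j = 0")
        case True then show ?thesis by (auto simp: u'_def)
      next
        case False
        then have "i < j" using sep ij by auto
        then have "(p - 1) * T j - q j \<le> (p - 1) * T i + w i"
          using pair[of i j] ij by (simp add: q_def w_def algebra_simps)
        then show ?thesis using u'0 v ij by (intro mult_left_mono) auto
      qed
    qed
    also have "(\<Sum>i<n. \<Sum>j<n. u' i * v j * ((p - 1) * T j - q j))
        = sum u' {..<n} * (\<Sum>j<n. v j * ((p - 1) * T j - q j))"
      by (simp add: sum_product mult.assoc)
    also have "(\<Sum>i<n. \<Sum>j<n. u' i * v j * ((p - 1) * T i + w i))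
        = (\<Sum>i<n. \<Sum>j<n. v j * (u' i * ((p - 1) * T i + w i)))"
      by (simp add: mult_ac)
    also have "\<dots> = sum v {..<n} * (\<Sum>i<n. u' i * ((p - 1) * T i + w i))"
      by (subst sum.swap) (simp add: sum_product)
    finally show ?thesis using V su' by simp
  qed
  have "g * (T m - t m) \<le> p * real (R m - m) * z m * T m - q m * Z m
      + v m * ((p - 1) * T m - q m) - u' m * ((p - 1) * T m + w m) + lam * (D m + \<bar>t m\<bar>)"
    if m: "m < n" for m
  proof -
    define N where "N = p * real (R m - m) * z m"
    define \<tau> where "\<tau> = N + (p - 1) * (v m - u' m)"
    \<comment> \<open>The coefficient of \<open>t m\<close> that remains after \<tau> times
      \<open>T m - t m\<close> has been split off. Its sign is unknown, hence the term with
      \<bar>\<open>t m\<close>\<bar>.\<close>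
    define c where "c = N - p * Z m - v m + u' m"
    have "(p - 1) * u' m \<le> (p - 1) * u m" using u'u[OF m] p by simp
    then have "g \<le> \<tau>" using T_coeff[OF m] by (simp add: \<tau>_def N_def algebra_simps)
    then have 1: "g * (T m - t m) \<le> \<tau> * (T m - t m)"
      using tT[OF m] by (intro mult_right_mono) auto
    have "\<bar>c\<bar> \<le> lam"
      using t_coeff[OF m] u'u[OF m] u'0[OF m] v[OF m] by (auto simp: c_def N_def abs_le_iff)
    then have "\<bar>c * t m\<bar> \<le> lam * \<bar>t m\<bar>" by (simp add: abs_mult mult_right_mono)
    then have 2: "0 \<le> c * t m + lam * \<bar>t m\<bar>" by (simp add: abs_le_iff)
    have "(Z m + v m + u' m) * D m \<le> lam * D m"
      using D_coeff[OF m] u'u[OF m] D[OF m] by (intro mult_right_mono) auto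
    with 1 2 show ?thesis
      unfolding N_def[symmetric] by (simp add: \<tau>_def c_def q_def w_def algebra_simps)
  qed
  then have "(\<Sum>m<n. g * (T m - t m)) \<le> (\<Sum>m<n. p * real (R m - m) * z m * T m - q m * Z m
      + v m * ((p - 1) * T m - q m) - u' m * ((p - 1) * T m + w m) + lam * (D m + \<bar>t m\<bar>))"
    by (intro sum_mono) simp
  also have "\<dots> \<le> lam * F + lam * (\<Sum>m<n. D m + \<bar>t m\<bar>)"
    using A B by (simp add: sum.distrib sum_subtractf distrib_left flip: sum_distrib_left)
  finally show ?thesis by (simp add: distrib_left flip: sum_distrib_left)
qed

section \<open>Piecewise linear weights\<close>

text \<open>In Bernstein form, a lower bound on the coefficients of a quadratic bounds it on the unit interval.\<close>

definition bern :: "real \<Rightarrow> real \<Rightarrow> real \<Rightarrow> real \<Rightarrow> real" where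
  "bern c0 c1 c2 x = c0 * (1 - x)\<^sup>2 + c1 * (2 * x * (1 - x)) + c2 * x\<^sup>2"

lemma bern_ge:
  assumes "w \<le> c0" "w \<le> c1" "w \<le> c2" "0 \<le> x" "x \<le> 1"
  shows "w \<le> bern c0 c1 c2 x"
proof -
  have "w * (1 - x)\<^sup>2 + w * (2 * x * (1 - x)) + w * x\<^sup>2 \<le> bern c0 c1 c2 x"
    unfolding bern_def using assms by (intro add_mono mult_right_mono) auto
  then show ?thesis by (simp add: power2_eq_square algebra_simps)
qed

lemma bern_combination:
  "c + d * bern z0 z1 z2 x + e * bern n0 n1 n2 x =
   bern (c + d * z0 + e * n0) (c + d * z1 + e * n1) (c + d * z2 + e * n2) x"
  by (simp add: bern_def power2_eq_square algebra_simps)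

text \<open>The bounds 3 and 5 are those of \<open>p\<close> and \<open>p + p / (p - 1)\<close>,
  which dominate the coefficients of Z and N in the conditions on the weights. Errors of at most
  \<open>h\<close> in both then cost at most \<open>8 * h\<close>.\<close>

lemma combination_nonneg:
  assumes c: "w \<le> c + d * z0 + e * n0" "w \<le> c + d * z1 + e * n1" "w \<le> c + d * z2 + e * n2"
    and x: "0 \<le> x" "x \<le> 1"
    and Z: "\<bar>Z - bern z0 z1 z2 x\<bar> \<le> h" and N: "\<bar>N - bern n0 n1 n2 x\<bar> \<le> h"
    and de: "\<bar>d\<bar> \<le> 3" "\<bar>e\<bar> \<le> 5" and h: "8 * h \<le> w"
  shows "0 \<le> c + d * Z + e * N"
proof -
  have "w \<le> c + d * bern z0 z1 z2 x + e * bern n0 n1 n2 x"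
    unfolding bern_combination by (rule bern_ge) fact+
  moreover have "\<bar>d * (Z - bern z0 z1 z2 x)\<bar> \<le> 3 * h"
    unfolding abs_mult using Z de by (intro mult_mono) auto
  moreover have "\<bar>e * (N - bern n0 n1 n2 x)\<bar> \<le> 5 * h"
    unfolding abs_mult using N de by (intro mult_mono) auto
  ultimately show ?thesis using h by (simp add: right_diff_distrib abs_le_iff)
qed

text \<open>Midpoint values integrate a linear function exactly, so the mass of a block does not
  depend on the number of clients in it.\<close>

lemma sum_linear_weights:
  fixes a b :: real
  assumes "0 < k"
  shows "(\<Sum>l<L. (a + (b - a) * (real l + 1/2) / real k) / real k)
    = a * (real L / real k) + (b - a) * (real L / real k)\<^sup>2 / 2"
proof (induction L)
  case (Suc L)
  show ?case
    unfolding sum.lessThan_Suc Suc.IH using assms by (simp add: field_simps power2_eq_square)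
qed simp

text \<open>The main term is \<open>k\<close> times the integral of (n - x)(a + (b - a)x) over the
  unit interval. Taking the first factor at the left ends of the cells errs upwards, so the balance
  condition needs no margin.\<close>

lemma sum_block_products_ge:
  fixes a b n :: real
  assumes k: "0 < k" and ab: "0 \<le> a" "0 \<le> b"
  shows "real k * (n * (a + b) / 2 - (a + 2 * b) / 6)
    \<le> (\<Sum>l<k. (n - real l / real k) * (a + (b - a) * (real l + 1/2) / real k))"
proof -
  have "(\<Sum>l<L. (n - real l / real k) * (a + (b - a) * (real l + 1/2) / real k))
    = n * a * L + n * (b - a) * (real L)\<^sup>2 / (2 * k) - a * L * (real L - 1) / (2 * k)
      - (b - a) * L * (real L - 1) * (4 * L + 1) / (12 * (real k)\<^sup>2)" for L
  proof (induction L)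
    case (Suc L)
    show ?case
      unfolding sum.lessThan_Suc Suc.IH using k by (simp add: field_simps power2_eq_square)
  qed simp
  also have "n * a * k + n * (b - a) * (real k)\<^sup>2 / (2 * k) - a * k * (real k - 1) / (2 * k)
      - (b - a) * k * (real k - 1) * (4 * k + 1) / (12 * (real k)\<^sup>2)
    = real k * (n * (a + b) / 2 - (a + 2 * b) / 6) + (a * (3 * real k - 1) + b * (3 * real k + 1)) / (12 * real k)"
    using k by (simp add: field_simps power2_eq_square)
  finally have *: "(\<Sum>l<k. (n - real l / real k) * (a + (b - a) * (real l + 1/2) / real k))
    = real k * (n * (a + b) / 2 - (a + 2 * b) / 6) + (a * (3 * real k - 1) + b * (3 * real k + 1)) / (12 * real k)" .
  have "0 \<le> (a * (3 * real k - 1) + b * (3 * real k + 1)) / (12 * real k)"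
    using k ab by (intro divide_nonneg_nonneg add_nonneg_nonneg mult_nonneg_nonneg) auto
  with * show ?thesis by linarith
qed


text \<open>The weight that earlier blocks put on inequalities in which the clients of block
  \<open>I\<close> make offers; a block has mass \<open>(a J + b J) / 2\<close>.\<close>

definition block_Z :: "(nat \<Rightarrow> nat) \<Rightarrow> (nat \<Rightarrow> real) \<Rightarrow> (nat \<Rightarrow> real) \<Rightarrow> nat \<Rightarrow> real" where
  "block_Z R a b I = (\<Sum>J | J < I \<and> I < R J. (a J + b J) / 2)"

text \<open>Let n = \<open>R I - I\<close> and let x in [0,1] be the relative position in block
  \<open>I\<close>. In the limit of many clients, Z(x) = \<open>block_Z R a b I\<close> + a x + (b -
  a) x^2 / 2 and N(x) = (n - x)(a + (b - a) x). The three pairs are the Bernstein coefficients of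
  (Z, N), so an affine lower bound valid at them is valid throughout the block.\<close>

definition control_points ::
  "(nat \<Rightarrow> nat) \<Rightarrow> (nat \<Rightarrow> real) \<Rightarrow> (nat \<Rightarrow> real) \<Rightarrow> nat \<Rightarrow> (real \<times> real) set" where
  "control_points R a b I =
    {(block_Z R a b I, real (R I - I) * a I),
     (block_Z R a b I + a I / 2, (real (R I - I) * b I + (real (R I - I) - 1) * a I) / 2),
     (block_Z R a b I + (a I + b I) / 2, (real (R I - I) - 1) * b I)}"

text \<open>
  The clients are divided into \<open>B\<close> blocks. Within block \<open>I\<close> the weight of the inequality on the offers
  goes linearly from \<open>a I\<close> to \<open>b I\<close>, and only the offers of the clients before block \<open>R I\<close> are kept.
  The inequalities between two clients pair the clients of the first \<open>E\<close> blocks with the others.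
  The margin \<open>w\<close> absorbs the discretisation error within the blocks.
\<close>

locale block_weights =
  fixes p g lam w :: real and B E :: nat and R :: "nat \<Rightarrow> nat" and a b :: "nat \<Rightarrow> real"
  assumes p: "2 \<le> p" "p \<le> 3" and g: "0 \<le> g" "g \<le> lam" and w: "0 < w"
    and B: "0 < B"
    and R: "\<And>I. I < B \<Longrightarrow> I < R I" "\<And>I. I < B \<Longrightarrow> R I \<le> B"
    and ab: "\<And>I. I < B \<Longrightarrow> 0 \<le> a I" "\<And>I. I < B \<Longrightarrow> a I \<le> 1"
      "\<And>I. I < B \<Longrightarrow> 0 \<le> b I" "\<And>I. I < B \<Longrightarrow> b I \<le> 1"
    and early: "\<And>I Z N. I < B \<Longrightarrow> I < E \<Longrightarrow>
        (Z, N) \<in> control_points R a b I \<Longrightarrow>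
        w \<le> p * N - g \<and>
        w \<le> lam + p * Z - p * N - (p * N - g) / (p - 1) \<and>
        w \<le> lam - p * Z + p * N \<and>
        w \<le> lam - Z - (p * N - g) / (p - 1)"
    and late: "\<And>I Z N. I < B \<Longrightarrow> \<not> I < E \<Longrightarrow>
        (Z, N) \<in> control_points R a b I \<Longrightarrow>
        w \<le> g - p * N \<and>
        w \<le> lam - p * Z + p * N - (g - p * N) / (p - 1) \<and>
        w \<le> lam - Z - (g - p * N) / (p - 1)"
    and total: "(\<Sum>I<B. (a I + b I) / 2) \<le> lam"
    and balance: "real B * g \<le> p * (\<Sum>I<B. real (R I - I) * (a I + b I) / 2 - (a I + 2 * b I) / 6)"
begin

abbreviation "Z0 \<equiv> block_Z R a b"
abbreviation "N0 \<equiv> \<lambda>I. real (R I - I) * a I"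
abbreviation "N1 \<equiv> \<lambda>I. (real (R I - I) * b I + (real (R I - I) - 1) * a I) / 2"
abbreviation "N2 \<equiv> \<lambda>I. (real (R I - I) - 1) * b I"

section \<open>Discretisation with \<open>k\<close> clients per block\<close>

context
  fixes k :: nat
  assumes k: "8 * real B \<le> w * real k"
begin

lemma k_pos: "0 < k"
  using k B by (cases k) auto

definition z :: "nat \<Rightarrow> real" where
  "z m = (a (m div k) + (b (m div k) - a (m div k)) * (real (m mod k) + 1/2) / real k) / real k"

text \<open>\<open>p * N m\<close> is the coefficient that the weighted offer inequalities give to
  the connection time of client \<open>m\<close>, and \<open>Z m\<close> below is the total weight
  of the inequalities that contain its offer.\<close>

definition N :: "nat \<Rightarrow> real" where "N m = real (k * R (m div k) - m) * z m"

definition Z :: "nat \<Rightarrow> real" where "Z m = (\<Sum>i | i \<le> m \<and> m < k * R (i div k). z i)"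

lemma z_block: "l < k \<Longrightarrow> z (I * k + l) = (a I + (b I - a I) * (real l + 1/2) / real k) / real k"
  by (simp add: z_def)

lemma sum_z_block: "(\<Sum>i = I * k..<I * k + k. z i) = (a I + b I) / 2"
proof -
  have "(\<Sum>i = I * k..<I * k + k. z i) = (\<Sum>l<k. z (I * k + l))"
    using sum.shift_bounds_nat_ivl[of z 0 "I * k" k] by (simp add: lessThan_atLeast0 add.commute)
  also have "\<dots> = (\<Sum>l<k. (a I + (b I - a I) * (real l + 1/2) / real k) / real k)"
    by (intro sum.cong) (auto simp: z_block)
  also have "\<dots> = (a I + b I) / 2"
    unfolding sum_linear_weights[OF k_pos] using k_pos by (simp add: field_simps)
  finally show ?thesis .
qed

lemma z_nonneg:
  assumes "m < B * k"
  shows "0 \<le> z m"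
proof -
  define I where "I = m div k"
  define y where "y = (real (m mod k) + 1/2) / real k"
  have I: "I < B" using assms k_pos by (simp add: I_def div_less_iff_less_mult)
  have "real (m mod k) + 1/2 \<le> real k" using k_pos mod_less_divisor[OF k_pos, of m] by linarith
  then have y: "0 \<le> y" "y \<le> 1" using k_pos by (auto simp: y_def)
  have "0 \<le> (1 - y) * a I + y * b I" using ab I y by simp
  also have "\<dots> = a I + (b I - a I) * y" by (simp add: algebra_simps)
  finally show ?thesis using k_pos by (simp add: z_def I_def y_def)
qed

text \<open>An earlier block contributes entirely or not at all, because \<open>R\<close> is
  constant on blocks. In block \<open>I\<close> the inequality of the client itself is included,
  hence \<open>Suc l\<close>.\<close>

lemma Z_eq:
  assumes l: "l < k" and I: "I < B"
  shows "Z (I * k + l) = Z0 I + a I * (real (Suc l) / real k) + (b I - a I) * (real (Suc l) / real k)\<^sup>2 / 2"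
proof -
  define m where "m = I * k + l"
  have lt: "m < k * J \<longleftrightarrow> I < J" for J
    using l unfolding m_def by (metis div_less_iff_less_mult div_mult_self3 div_less add_0
        mult.commute gr_implies_not0 add.right_neutral not_gr_zero)
  have "{i. i \<le> m \<and> m < k * R (i div k)} = {i \<in> {..<I * k}. I < R (i div k)} \<union> {I * k..<I * k + Suc l}"
  proof -
    have "I < R (i div k)" if "I * k \<le> i" "i \<le> m" for i
    proof -
      have "i div k = I" using that l unfolding m_def
        by (intro div_nat_eqI) (auto simp: mult.commute)
      then show ?thesis using R(1)[OF I] by simp
    qed
    then show ?thesis by (auto simp: lt) (auto simp: m_def)
  qed
  then have "Z m = (\<Sum>i | i \<in> {..<I * k} \<and> I < R (i div k). z i) + (\<Sum>i = I * k..<I * k + Suc l. z i)"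
    unfolding Z_def by (subst sum.union_disjoint[symmetric]) (auto intro!: sum.cong)
  also have "(\<Sum>i | i \<in> {..<I * k} \<and> I < R (i div k). z i) = Z0 I"
  proof -
    have "(\<Sum>i | i \<in> {..<I * k} \<and> I < R (i div k). z i)
        = (\<Sum>i<I * k. if I < R (i div k) then z i else 0)"
      by (rule sum.inter_filter) simp
    also have "\<dots> = (\<Sum>J<I. \<Sum>i = J * k..<J * k + k. if I < R (i div k) then z i else 0)"
      by (rule sum.nat_group[symmetric])
    also have "\<dots> = (\<Sum>J<I. if I < R J then (a J + b J) / 2 else 0)"
    proof (rule sum.cong[OF refl])
      fix J
      have "i div k = J" if "i \<in> {J * k..<J * k + k}" for i
        using that by (intro div_nat_eqI) (auto simp: mult.commute)
      then have "(\<Sum>i = J * k..<J * k + k. if I < R (i div k) then z i else 0)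
          = (\<Sum>i = J * k..<J * k + k. if I < R J then z i else 0)"
        by (intro sum.cong) auto
      then show "(\<Sum>i = J * k..<J * k + k. if I < R (i div k) then z i else 0)
          = (if I < R J then (a J + b J) / 2 else 0)"
        by (simp add: sum_z_block)
    qed
    also have "\<dots> = Z0 I"
      unfolding block_Z_def using sum.inter_filter[of "{..<I}" "\<lambda>J. (a J + b J) / 2" "\<lambda>J. I < R J"] by simp
    finally show ?thesis .
  qed
  also have "(\<Sum>i = I * k..<I * k + Suc l. z i) = (\<Sum>l<Suc l. z (I * k + l))"
    using sum.shift_bounds_nat_ivl[of z 0 "I * k" "Suc l"]
    by (simp only: lessThan_atLeast0 add.commute add_0 add_0_right)
  also have "\<dots> = (\<Sum>l<Suc l. (a I + (b I - a I) * (real l + 1/2) / real k) / real k)"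
    using l by (intro sum.cong) (auto simp: z_block)
  also have "\<dots> = a I * (real (Suc l) / real k) + (b I - a I) * (real (Suc l) / real k)\<^sup>2 / 2"
    by (rule sum_linear_weights[OF k_pos])
  finally show ?thesis by (simp add: m_def)
qed

lemma N_eq:
  assumes l: "l < k" and I: "I < B"
  shows "N (I * k + l) = (real (R I - I) - real l / real k) * (a I + (b I - a I) * (real l + 1/2) / real k)"
proof -
  have "I * k + k \<le> k * R I" using R(1)[OF I]
    by (metis Suc_leI add.commute mult.commute mult_Suc mult_le_mono1)
  then have "real (k * R I - (I * k + l)) = real k * (real (R I - I) - real l / real k)"
    using l k_pos R(1)[OF I] by (simp add: field_simps of_nat_diff)
  then show ?thesis using l k_pos by (simp add: N_def z_block)
qed

lemma Z_approx:
  assumes l: "l < k" and I: "I < B"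
  shows "\<bar>Z (I * k + l) - bern (Z0 I) (Z0 I + a I / 2) (Z0 I + (a I + b I) / 2) (real l / real k)\<bar> \<le> w / 8"
proof -
  define x where "x = real l / real k"
  define h where "h = 1 / real k"
  have x: "0 \<le> x" "x + h \<le> 1" "0 \<le> h" using l k_pos by (auto simp: x_def h_def field_simps)
  have xh: "real (Suc l) / real k = x + h" by (simp add: x_def h_def add_divide_distrib)
  have "Z (I * k + l) - bern (Z0 I) (Z0 I + a I / 2) (Z0 I + (a I + b I) / 2) x
      = h * (a I * (1 - x - h / 2) + b I * (x + h / 2))"
    unfolding Z_eq[OF l I] xh bern_def by (simp add: power2_eq_square field_simps)
  moreover have "0 \<le> a I * (1 - x - h / 2) + b I * (x + h / 2)"
    using ab[OF I] x by (intro add_nonneg_nonneg mult_nonneg_nonneg) auto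
  moreover have "a I * (1 - x - h / 2) + b I * (x + h / 2) \<le> 1 * (1 - x - h / 2) + 1 * (x + h / 2)"
    using ab[OF I] x by (intro add_mono mult_right_mono) auto
  ultimately have "\<bar>Z (I * k + l) - bern (Z0 I) (Z0 I + a I / 2) (Z0 I + (a I + b I) / 2) x\<bar> \<le> h * 1"
    using x by (simp add: abs_mult mult_left_le)
  also have "h \<le> w / 8"
  proof -
    have "8 * 1 \<le> w * real k" using k B by linarith
    then show ?thesis using k_pos by (simp add: h_def field_simps)
  qed
  finally show ?thesis by (simp add: x_def)
qed

lemma N_approx:
  assumes l: "l < k" and I: "I < B"
  shows "\<bar>N (I * k + l) - bern (N0 I) (N1 I) (N2 I) (real l / real k)\<bar> \<le> w / 8"
proof -
  define x where "x = real l / real k"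
  define n where "n = real (R I - I)"
  have x: "0 \<le> x" "x \<le> 1" using l k_pos by (auto simp: x_def)
  have n: "1 \<le> n" "n \<le> real B" using R[OF I] by (auto simp: n_def)
  have xh: "(real l + 1/2) / real k = x + 1 / (2 * real k)" by (simp add: x_def add_divide_distrib)
  have "N (I * k + l) - bern (N0 I) (N1 I) (N2 I) x = (n - x) * (b I - a I) / (2 * real k)"
    unfolding N_eq[OF l I] bern_def times_divide_eq_right[symmetric] xh
    by (simp add: n_def[symmetric] x_def[symmetric])
       (simp add: power2_eq_square algebra_simps add_divide_distrib diff_divide_distrib)
  moreover have "\<bar>(n - x) * (b I - a I)\<bar> \<le> real B * 1"
    unfolding abs_mult using n x ab[OF I] by (intro mult_mono) auto
  ultimately have "\<bar>N (I * k + l) - bern (N0 I) (N1 I) (N2 I) x\<bar> \<le> real B / (2 * real k)"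
    using k_pos by (simp add: divide_right_mono)
  also have "\<dots> \<le> w / 8" using k k_pos by (simp add: field_simps)
  finally show ?thesis by (simp add: x_def)
qed

lemma item_nonneg:
  assumes l: "l < k" and I: "I < B"
    and *: "\<And>Z N. (Z, N) \<in> control_points R a b I \<Longrightarrow>
      w \<le> c + d * Z + e * N"
    and de: "\<bar>d\<bar> \<le> 3" "\<bar>e\<bar> \<le> 5"
  shows "0 \<le> c + d * Z (I * k + l) + e * N (I * k + l)"
  by (rule combination_nonneg[OF *[of "Z0 I" "N0 I"] *[of "Z0 I + a I / 2" "N1 I"]
        *[of "Z0 I + (a I + b I) / 2" "N2 I"] _ _ Z_approx[OF l I] N_approx[OF l I] de])
     (use l k_pos in \<open>auto simp: control_points_def\<close>)

lemma p_ratio: "p / (p - 1) \<le> 2" "0 \<le> p / (p - 1)"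
  using p by (auto simp: field_simps)

lemma item_early:
  assumes "m < B * k" "m div k < E"
  shows "g \<le> p * N m" "0 \<le> lam + p * Z m - p * N m - (p * N m - g) / (p - 1)"
    "0 \<le> lam - p * Z m + p * N m" "0 \<le> lam - Z m - (p * N m - g) / (p - 1)"
proof -
  define I l where "I = m div k" and "l = m mod k"
  have m: "m = I * k + l" by (simp add: I_def l_def)
  have I: "I < B" "I < E" and l: "l < k"
    using assms k_pos by (auto simp: I_def l_def div_less_iff_less_mult)
  note early = early[OF I]
  have "w \<le> - g + 0 * Z + p * N"
    if "(Z, N) \<in> control_points R a b I" for Z N
    using early[OF that] by simp
  from item_nonneg[OF l I(1) this] p show "g \<le> p * N m" by (simp add: m)
  have "w \<le> (lam + g / (p - 1)) + p * Z + (- p - p / (p - 1)) * N"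
    if "(Z, N) \<in> control_points R a b I" for Z N
    using early[OF that] by (simp add: diff_divide_distrib left_diff_distrib)
  from item_nonneg[OF l I(1) this] p p_ratio
  show "0 \<le> lam + p * Z m - p * N m - (p * N m - g) / (p - 1)"
    by (simp add: m diff_divide_distrib left_diff_distrib)
  have "w \<le> lam + (- p) * Z + p * N"
    if "(Z, N) \<in> control_points R a b I" for Z N
    using early[OF that] by simp
  from item_nonneg[OF l I(1) this] p show "0 \<le> lam - p * Z m + p * N m" by (simp add: m)
  have "w \<le> (lam + g / (p - 1)) + (- 1) * Z + (- (p / (p - 1))) * N"
    if "(Z, N) \<in> control_points R a b I" for Z N
    using early[OF that] by (simp add: diff_divide_distrib left_diff_distrib)
  from item_nonneg[OF l I(1) this] p p_ratio
  show "0 \<le> lam - Z m - (p * N m - g) / (p - 1)"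
    by (simp add: m diff_divide_distrib)
qed

lemma item_late:
  assumes "m < B * k" "\<not> m div k < E"
  shows "p * N m \<le> g" "0 \<le> lam - p * Z m + p * N m - (g - p * N m) / (p - 1)"
    "0 \<le> lam - Z m - (g - p * N m) / (p - 1)"
proof -
  define I l where "I = m div k" and "l = m mod k"
  have m: "m = I * k + l" by (simp add: I_def l_def)
  have I: "I < B" "\<not> I < E" and l: "l < k"
    using assms k_pos by (auto simp: I_def l_def div_less_iff_less_mult)
  note late = late[OF I]
  have "w \<le> g + 0 * Z + (- p) * N"
    if "(Z, N) \<in> control_points R a b I" for Z N
    using late[OF that] by simp
  from item_nonneg[OF l I(1) this] p show "p * N m \<le> g" by (simp add: m)
  have "w \<le> (lam - g / (p - 1)) + (- p) * Z + (p + p / (p - 1)) * N"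
    if "(Z, N) \<in> control_points R a b I" for Z N
    using late[OF that] by (simp add: diff_divide_distrib distrib_right)
  from item_nonneg[OF l I(1) this] p p_ratio
  show "0 \<le> lam - p * Z m + p * N m - (g - p * N m) / (p - 1)"
    by (simp add: m diff_divide_distrib distrib_right)
  have "w \<le> (lam - g / (p - 1)) + (- 1) * Z + (p / (p - 1)) * N"
    if "(Z, N) \<in> control_points R a b I" for Z N
    using late[OF that] by (simp add: diff_divide_distrib distrib_right)
  from item_nonneg[OF l I(1) this] p p_ratio
  show "0 \<le> lam - Z m - (g - p * N m) / (p - 1)"
    by (simp add: m diff_divide_distrib)
qed

lemma sum_N_ge: "real (B * k) * g \<le> p * (\<Sum>m<B * k. N m)"
proof -
  have "real k * (real B * g)
      \<le> real k * (p * (\<Sum>I<B. real (R I - I) * (a I + b I) / 2 - (a I + 2 * b I) / 6))"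
    using balance by (intro mult_left_mono) auto
  also have "\<dots> = p * (\<Sum>I<B. real k * (real (R I - I) * (a I + b I) / 2 - (a I + 2 * b I) / 6))"
    by (simp add: sum_distrib_left mult_ac)
  also have "\<dots> \<le> p * (\<Sum>I<B. \<Sum>l<k. N (I * k + l))"
  proof (intro mult_left_mono sum_mono)
    fix I assume I: "I \<in> {..<B}"
    have "(\<Sum>l<k. N (I * k + l))
        = (\<Sum>l<k. (real (R I - I) - real l / real k) * (a I + (b I - a I) * (real l + 1/2) / real k))"
      using I by (intro sum.cong) (auto simp: N_eq)
    then show "real k * (real (R I - I) * (a I + b I) / 2 - (a I + 2 * b I) / 6)
        \<le> (\<Sum>l<k. N (I * k + l))"
      using sum_block_products_ge[OF k_pos, of "a I" "b I" "real (R I - I)"] ab[of I] I by simp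
  qed (use p in auto)
  also have "(\<Sum>I<B. \<Sum>l<k. N (I * k + l)) = (\<Sum>I<B. \<Sum>m = I * k..<I * k + k. N m)"
  proof (rule sum.cong[OF refl])
    fix I
    show "(\<Sum>l<k. N (I * k + l)) = (\<Sum>m = I * k..<I * k + k. N m)"
      using sum.shift_bounds_nat_ivl[of N 0 "I * k" k] by (simp add: lessThan_atLeast0 add.commute)
  qed
  also have "\<dots> = (\<Sum>m<B * k. N m)" by (rule sum.nat_group)
  finally show ?thesis by (simp add: mult_ac)
qed

text \<open>Requiring that each \<open>T m\<close> gets coefficient exactly \<open>g\<close>
  determines \<open>u m - v m\<close>. Its sign is nonnegative on early and nonpositive on late
  blocks, which yields \<open>u\<close> and \<open>v\<close>; \<open>balance\<close> then says that
  \<open>u\<close> has at least the mass of \<open>v\<close>.\<close>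

lemma items_bound:
  fixes T t D :: "nat \<Rightarrow> real" and F :: real
  assumes block: "\<And>m r. m < B * k \<Longrightarrow> r \<le> B * k \<Longrightarrow>
      p * real (r - m) * T m - (\<Sum>i=m..<r. p * t i + D i) \<le> F"
    and pair: "\<And>i j. i < j \<Longrightarrow> j < B * k \<Longrightarrow>
      (p - 1) * (T j - T i) \<le> D i + D j + p * (t j - t i)"
    and tT: "\<And>m. m < B * k \<Longrightarrow> t m \<le> T m" and D: "\<And>m. m < B * k \<Longrightarrow> 0 \<le> D m" and F: "0 \<le> F"
  shows "g * (\<Sum>m<B * k. T m - t m) \<le> lam * (F + (\<Sum>m<B * k. D m + \<bar>t m\<bar>))"
proof -
  define u where "u = (\<lambda>m. if m div k < E then (p * N m - g) / (p - 1) else 0)"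
  define v where "v = (\<lambda>m. if m div k < E then 0 else (g - p * N m) / (p - 1))"
  have uv: "u m - v m = (p * N m - g) / (p - 1)" for m
    using p by (auto simp: u_def v_def field_simps)
  show ?thesis
  proof (rule weak_duality[where z = z and u = u and v = v and R = "\<lambda>m. k * R (m div k)" and p = p])
    fix m assume m: "m < B * k"
    have I: "m div k < B" using m k_pos by (simp add: div_less_iff_less_mult)
    show R': "k * R (m div k) \<le> B * k" using R(2)[OF I] by (simp add: mult.commute)
    show "p * real (k * R (m div k) - m) * T m - (\<Sum>i = m..<k * R (m div k). p * t i + D i) \<le> F"
      by (rule block[OF m R'])
    show "0 \<le> z m" by (rule z_nonneg[OF m])
    show u0: "0 \<le> u m" using item_early(1)[OF m] p by (auto simp: u_def)
    show v0: "0 \<le> v m" using item_late(1)[OF m] p by (auto simp: v_def)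
    have N: "p * real (k * R (m div k) - m) * z m = p * N m" by (simp add: N_def)
    have "(p - 1) * (v m - u m) = g - p * N m"
      using uv[of m] p by (simp add: field_simps)
    then show "g \<le> p * real (k * R (m div k) - m) * z m + (p - 1) * (v m - u m)"
      unfolding N by simp
    note Z = Z_def[symmetric]
    show "p * (\<Sum>i | i \<le> m \<and> m < k * R (i div k). z i) - p * real (k * R (m div k) - m) * z m + v m \<le> lam"
      unfolding N Z using item_early(3)[OF m] item_late(2)[OF m] by (auto simp: v_def)
    show "- lam \<le> p * (\<Sum>i | i \<le> m \<and> m < k * R (i div k). z i) - p * real (k * R (m div k) - m) * z m - u m"
    proof (cases "m div k < E")
      case True
      then show ?thesis unfolding N Z using item_early(2)[OF m] by (simp add: u_def)
    next
      case False
      \<comment> \<open>On late blocks this dual constraint is not listed among the conditions: it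
        follows from \<open>p * N m\<close> \<le> \<open>g\<close> \<le> \<open>lam\<close>.\<close>
      have "0 \<le> Z m" unfolding Z_def using m by (intro sum_nonneg z_nonneg) auto
      then have "0 \<le> p * Z m" using p by simp
      then show ?thesis unfolding N Z using item_late(1)[OF m False] g False by (simp add: u_def)
    qed
    show "(\<Sum>i | i \<le> m \<and> m < k * R (i div k). z i) + u m + v m \<le> lam"
      unfolding Z using item_early(4)[OF m] item_late(3)[OF m] by (auto simp: u_def v_def)
  next
    fix i j assume "i < B * k" "j < B * k" and uv: "u i \<noteq> 0" "v j \<noteq> 0"
    then have "i div k < j div k" by (auto simp: u_def v_def split: if_splits)
    then show "i < j" by (meson div_le_mono leD leI)
  next
    have "(\<Sum>m<B * k. z m) = (\<Sum>I<B. \<Sum>m = I * k..<I * k + k. z m)"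
      by (rule sum.nat_group[symmetric])
    then show "(\<Sum>m<B * k. z m) \<le> lam" using total by (simp add: sum_z_block)
  next
    have "0 \<le> (p * (\<Sum>m<B * k. N m) - real (B * k) * g) / (p - 1)"
      using sum_N_ge p by simp
    also have "\<dots> = (\<Sum>m<B * k. u m - v m)"
      unfolding uv by (simp add: sum_subtractf sum_distrib_left flip: sum_divide_distrib)
    finally show "sum v {..<B * k} \<le> sum u {..<B * k}" by (simp add: sum_subtractf)
  qed (use assms p in auto)
qed

end

end

section \<open>Numerical weights\<close>

text \<open>
  A row \<open>(r, a, b)\<close> stands for a block with \<open>R = r\<close> and with weights \<open>a / 10^6\<close> and \<open>b / 10^6\<close> at its ends.
  The numbers come from a linear programming solver, after a local search over the column \<open>r\<close>.
\<close>

definition dual_table :: "(int \<times> int \<times> int) list" where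
  "dual_table =
  [(46, 29381, 30435), (46, 30466, 31583), (46, 31617, 32803), (46, 32839, 34100),
   (46, 34139, 35481), (46, 35524, 36954), (56, 29601, 30578), (57, 29993, 30982),
   (58, 30389, 31392), (58, 31419, 32477), (59, 31843, 32916), (59, 32945, 34078),
   (60, 33399, 34548), (61, 33860, 35024), (62, 34326, 35507), (62, 35540, 36788),
   (62, 36824, 38145), (63, 37354, 38694), (64, 37891, 39251), (64, 39291, 40732),
   (65, 39869, 41331), (65, 41375, 42927), (66, 41998, 43574), (67, 42631, 44230),
   (67, 44279, 45978), (68, 44962, 46687), (68, 46742, 48578), (69, 47480, 49345),
   (70, 48229, 50124), (70, 50186, 52206), (71, 50998, 53050), (71, 53118, 55310),
   (72, 54000, 56228), (72, 56304, 58686), (73, 57262, 59686), (74, 58237, 60702),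
   (74, 60788, 63428), (75, 61851, 64537), (75, 64633, 67516), (76, 65795, 68729),
   (77, 66977, 69964), (77, 70074, 73287), (78, 71369, 74291), (78, 74291, 75033),
   (79, 72903, 73632), (80, 71542, 72257), (80, 76052, 76834), (81, 74589, 75357),
   (81, 75372, 76171), (82, 73879, 74662), (83, 72415, 73183), (83, 42175, 42055),
   (84, 35708, 37629), (84, 37629, 39722), (85, 38440, 40578), (85, 40578, 42914),
   (86, 40831, 43181), (86, 42497, 45031), (87, 42069, 44578), (87, 43048, 45711),
   (88, 43289, 45968), (88, 45138, 48039), (88, 45324, 48355), (89, 45544, 48591),
   (89, 46546, 49791), (90, 45647, 48829), (90, 47669, 51139), (100, 33897, 35663),
   (100, 33763, 35580), (100, 34564, 36486), (100, 34310, 36285), (100, 33903, 35924),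
   (100, 33309, 35370), (100, 33961, 36144), (100, 33103, 35317), (100, 31954, 34182),
   (100, 32359, 34714), (100, 30751, 33093), (100, 28733, 31026), (100, 28757, 31169),
   (100, 26346, 28674), (100, 23514, 25710), (100, 23026, 25305), (100, 20909, 23111),
   (100, 20048, 22303), (100, 18780, 21046), (100, 17062, 19284), (100, 14896, 17002),
   (100, 9520, 10991), (100, 5361, 6275), (100, 0, 0), (100, 0, 0), (100, 0, 0), (100, 0, 0),
   (100, 0, 0), (100, 0, 0), (100, 0, 0), (100, 0, 0), (100, 0, 0), (100, 0, 0)]"

text \<open>
  Below, the conditions on the weights for \<open>p = 143/50\<close> and \<open>\<lambda> = 2418/625\<close> are multiplied by common
  denominators to become inequalities between integers. Here \<open>Z\<close> and \<open>N\<close> are in units of \<open>1/2000000\<close>.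
\<close>

definition Z_units :: "int \<Rightarrow> (int \<times> int) list \<Rightarrow> int" where
  "Z_units I ws = sum_list (map (\<lambda>w. if I < fst w then snd w else 0) ws)"

definition early_ok :: "int \<Rightarrow> int \<Rightarrow> bool" where
  "early_ok Z N \<longleftrightarrow> 386010000 \<le> 143 * N \<and>
     930000 \<le> 35979840000 + 13299 * (Z - N) - 50 * (143 * N - 386000000) \<and>
     10000 \<le> 386880000 + 143 * (N - Z) \<and>
     18600 \<le> 719596800 - 93 * Z - (143 * N - 386000000)"

definition late_ok :: "int \<Rightarrow> int \<Rightarrow> bool" where
  "late_ok Z N \<longleftrightarrow> 143 * N \<le> 385990000 \<and>
     930000 \<le> 35979840000 - 13299 * (Z - N) + 50 * (143 * N - 386000000) \<and>
     18600 \<le> 719596800 - 93 * Z + (143 * N - 386000000)"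

definition point_ok :: "int \<Rightarrow> int \<Rightarrow> int \<Rightarrow> bool" where
  "point_ok I Z N \<longleftrightarrow> (if I < 51 then early_ok Z N else late_ok Z N)"

definition row_ok :: "int \<Rightarrow> int \<times> int \<times> int \<Rightarrow> int \<Rightarrow> bool" where
  "row_ok I x Z = (case x of (r, a, b) \<Rightarrow>
     I < r \<and> r \<le> 100 \<and> 0 \<le> a \<and> a \<le> 1000000 \<and> 0 \<le> b \<and> b \<le> 1000000 \<and>
     point_ok I Z (2 * (r - I) * a) \<and>
     point_ok I (Z + a) ((r - I) * b + (r - I - 1) * a) \<and>
     point_ok I (Z + a + b) (2 * (r - I - 1) * b))"

text \<open>\<open>ws\<close> accumulates the end and the doubled mass of each row already passed,
  so that one traversal supplies the value of Z to every row.\<close>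

primrec rows_ok :: "int \<Rightarrow> (int \<times> int) list \<Rightarrow> (int \<times> int \<times> int) list \<Rightarrow> bool" where
  "rows_ok I ws [] = True"
| "rows_ok I ws (x # xs) \<longleftrightarrow> row_ok I x (Z_units I ws) \<and>
     rows_ok (I + 1) ((fst x, fst (snd x) + snd (snd x)) # ws) xs"

text \<open>In units of 1/6000000, owing to the denominators 2 and 6 in \<open>balance\<close>. The
  threshold 115800000000 used below is 100 * 193 * 6000000.\<close>

primrec balance_units :: "int \<Rightarrow> (int \<times> int \<times> int) list \<Rightarrow> int" where
  "balance_units I [] = 0"
| "balance_units I (x # xs) = (case x of (r, a, b) \<Rightarrow> 3 * (r - I) * (a + b) - (a + 2 * b))
     + balance_units (I + 1) xs"

section \<open>Verification of the table in integer arithmetic\<close>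

lemma dual_table_length: "length dual_table = 100"
  by (simp add: dual_table_def)

lemma dual_table_rows: "rows_ok 0 [] dual_table"
  by code_simp

lemma dual_table_total: "sum_list (map (\<lambda>x. fst (snd x) + snd (snd x)) dual_table) \<le> 7737600"
  by code_simp

lemma dual_table_balance: "115800000000 \<le> 143 * balance_units 0 dual_table"
  by code_simp

lemma rows_ok_nth:
  assumes "rows_ok I ws xs" "i < length xs"
  shows "row_ok (I + int i) (xs ! i)
    (Z_units (I + int i) (rev (map (\<lambda>x. (fst x, fst (snd x) + snd (snd x))) (take i xs)) @ ws))"
  using assms
proof (induction xs arbitrary: I ws i)
  case (Cons x xs)
  show ?case
  proof (cases i)
    case (Suc i')
    then show ?thesis using Cons.IH[of "I + 1" "(fst x, fst (snd x) + snd (snd x)) # ws" i'] Cons.prems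
      by (simp add: algebra_simps)
  qed (use Cons.prems in simp)
qed simp

lemma balance_units_eq:
  "balance_units I xs = (\<Sum>i<length xs. 3 * (fst (xs ! i) - (I + int i)) *
     (fst (snd (xs ! i)) + snd (snd (xs ! i))) - (fst (snd (xs ! i)) + 2 * snd (snd (xs ! i))))"
proof (induction xs arbitrary: I)
  case (Cons x xs)
  then show ?case by (simp add: sum.lessThan_Suc_shift algebra_simps split: prod.split del: sum.lessThan_Suc)
qed simp

definition table_R :: "nat \<Rightarrow> nat" where "table_R I = nat (fst (dual_table ! I))"
definition table_a :: "nat \<Rightarrow> real" where "table_a I = fst (snd (dual_table ! I)) / 1000000"
definition table_b :: "nat \<Rightarrow> real" where "table_b I = snd (snd (dual_table ! I)) / 1000000"

lemma early_ok:
  assumes "early_ok Z' N'" and Z: "Z = real_of_int Z' / 2000000" and N: "N = real_of_int N' / 2000000"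
  shows "1/10000 \<le> 143/50 * N - 193/50 \<and>
    1/10000 \<le> 2418/625 + 143/50 * Z - 143/50 * N - (143/50 * N - 193/50) / (143/50 - 1) \<and>
    1/10000 \<le> 2418/625 - 143/50 * Z + 143/50 * N \<and>
    1/10000 \<le> 2418/625 - Z - (143/50 * N - 193/50) / (143/50 - 1)"
proof -
  have "real_of_int 386010000 \<le> real_of_int (143 * N')"
    "real_of_int 930000 \<le> real_of_int (35979840000 + 13299 * (Z' - N') - 50 * (143 * N' - 386000000))"
    "real_of_int 10000 \<le> real_of_int (386880000 + 143 * (N' - Z'))"
    "real_of_int 18600 \<le> real_of_int (719596800 - 93 * Z' - (143 * N' - 386000000))"
    using assms(1) unfolding early_ok_def of_int_le_iff by blast+
  then show ?thesis unfolding Z N by (simp add: field_simps)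
qed

lemma late_ok:
  assumes "late_ok Z' N'" and Z: "Z = real_of_int Z' / 2000000" and N: "N = real_of_int N' / 2000000"
  shows "1/10000 \<le> 193/50 - 143/50 * N \<and>
    1/10000 \<le> 2418/625 - 143/50 * Z + 143/50 * N - (193/50 - 143/50 * N) / (143/50 - 1) \<and>
    1/10000 \<le> 2418/625 - Z - (193/50 - 143/50 * N) / (143/50 - 1)"
proof -
  have "real_of_int (143 * N') \<le> real_of_int 385990000"
    "real_of_int 930000 \<le> real_of_int (35979840000 - 13299 * (Z' - N') + 50 * (143 * N' - 386000000))"
    "real_of_int 18600 \<le> real_of_int (719596800 - 93 * Z' + (143 * N' - 386000000))"
    using assms(1) unfolding late_ok_def of_int_le_iff by blast+
  then show ?thesis unfolding Z N by (simp add: field_simps)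
qed

lemma table_row:
  assumes "I < 100"
  shows "\<exists>Z. block_Z table_R table_a table_b I = real_of_int Z / 2000000 \<and> row_ok (int I) (dual_table ! I) Z"
proof -
  define f where "f = (\<lambda>x::int \<times> int \<times> int. (fst x, fst (snd x) + snd (snd x)))"
  define Z where "Z = Z_units (int I) (rev (map f (take I dual_table)))"
  have ok: "row_ok (int I) (dual_table ! I) Z"
    using rows_ok_nth[OF dual_table_rows, of I] assms by (simp add: dual_table_length Z_def f_def)
  have len: "length (take I dual_table) = I" using assms by (simp add: dual_table_length)
  have "Z = (\<Sum>J<I. if int I < fst (dual_table ! J) then snd (f (dual_table ! J)) else 0)"
  proof -
    have "Z = sum_list (map (\<lambda>x. if int I < fst (f x) then snd (f x) else 0) (take I dual_table))"
      unfolding Z_def Z_units_def by (simp add: rev_map[symmetric] sum_list.rev comp_def)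
    then show ?thesis
      using assms by (auto simp: sum_list_sum_nth dual_table_length min_def lessThan_atLeast0 intro!: sum.cong)
        (simp_all add: f_def)
  qed
  then have "real_of_int Z / 2000000
      = (\<Sum>J<I. if I < table_R J then (table_a J + table_b J) / 2 else 0)"
    by (auto simp: sum_divide_distrib f_def table_R_def table_a_def table_b_def zless_nat_eq_int_zless
        add_divide_distrib intro!: sum.cong)
  also have "\<dots> = block_Z table_R table_a table_b I"
    unfolding block_Z_def
    using sum.inter_filter[of "{..<I}" "\<lambda>J. (table_a J + table_b J) / 2" "\<lambda>J. I < table_R J"] by simp
  finally show ?thesis using ok by metis
qed

text \<open>The parameters are \<gamma> - 1, \<gamma>, the factor 3.8688 and the margin; 51 of the
  100 blocks are early.\<close>

interpretation table: block_weights "143/50" "193/50" "2418/625" "1/10000" 100 51 table_R table_a table_b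
proof
  fix I :: nat assume I: "I < 100"
  obtain r a b where x: "dual_table ! I = (r, a, b)" by (cases "dual_table ! I")
  obtain Z' where Z': "block_Z table_R table_a table_b I = real_of_int Z' / 2000000"
    and ok: "row_ok (int I) (r, a, b) Z'"
    using table_row[OF I] by (auto simp: x)
  have b: "int I < r" "r \<le> 100" "0 \<le> a" "a \<le> 1000000" "0 \<le> b" "b \<le> 1000000"
    using ok by (auto simp: row_ok_def)
  show "I < table_R I" "table_R I \<le> 100" "0 \<le> table_a I" "table_a I \<le> 1" "0 \<le> table_b I" "table_b I \<le> 1"
    using b by (auto simp: table_R_def table_a_def table_b_def x)
  have n: "real (table_R I - I) = real_of_int (r - int I)"
    using b by (simp add: table_R_def x)
  have points: "\<exists>Z'' N''. point_ok (int I) Z'' N'' \<and> Z = real_of_int Z'' / 2000000 \<and> N = real_of_int N'' / 2000000"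
    if "(Z, N) \<in> control_points table_R table_a table_b I" for Z N
  proof -
    have "control_points table_R table_a table_b I =
      {(real_of_int Z' / 2000000, real_of_int (2 * (r - int I) * a) / 2000000),
       (real_of_int (Z' + a) / 2000000, real_of_int ((r - int I) * b + (r - int I - 1) * a) / 2000000),
       (real_of_int (Z' + a + b) / 2000000, real_of_int (2 * (r - int I - 1) * b) / 2000000)}"
      unfolding control_points_def n Z' table_a_def table_b_def x
      by (simp add: add_divide_distrib diff_divide_distrib left_diff_distrib right_diff_distrib add.assoc mult.commute)
    with that consider "Z = real_of_int Z' / 2000000 \<and> N = real_of_int (2 * (r - int I) * a) / 2000000"
      | "Z = real_of_int (Z' + a) / 2000000 \<and> N = real_of_int ((r - int I) * b + (r - int I - 1) * a) / 2000000"
      | "Z = real_of_int (Z' + a + b) / 2000000 \<and> N = real_of_int (2 * (r - int I - 1) * b) / 2000000"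
      by blast
    then show ?thesis using ok unfolding row_ok_def prod.case by cases blast+
  qed
  {
    fix Z N assume ZN: "(Z, N) \<in> control_points table_R table_a table_b I"
    from points[OF this] obtain Z'' N'' where "point_ok (int I) Z'' N''"
      and Z: "Z = real_of_int Z'' / 2000000" and N: "N = real_of_int N'' / 2000000" by blast
    then have "(I < 51 \<longrightarrow> early_ok Z'' N'') \<and> (\<not> I < 51 \<longrightarrow> late_ok Z'' N'')"
      by (auto simp: point_ok_def split: if_splits)
    with early_ok[OF _ Z N] late_ok[OF _ Z N]
    show "I < 51 \<Longrightarrow> 1/10000 \<le> 143/50 * N - 193/50 \<and>
      1/10000 \<le> 2418/625 + 143/50 * Z - 143/50 * N - (143/50 * N - 193/50) / (143/50 - 1) \<and>
      1/10000 \<le> 2418/625 - 143/50 * Z + 143/50 * N \<and>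
      1/10000 \<le> 2418/625 - Z - (143/50 * N - 193/50) / (143/50 - 1)"
      "\<not> I < 51 \<Longrightarrow> 1/10000 \<le> 193/50 - 143/50 * N \<and>
      1/10000 \<le> 2418/625 - 143/50 * Z + 143/50 * N - (193/50 - 143/50 * N) / (143/50 - 1) \<and>
      1/10000 \<le> 2418/625 - Z - (193/50 - 143/50 * N) / (143/50 - 1)"
      by blast+
  }
next
  have "(\<Sum>I<100. (table_a I + table_b I) / 2)
      = real_of_int (\<Sum>I<100. fst (snd (dual_table ! I)) + snd (snd (dual_table ! I))) / 2000000"
    by (simp add: sum_divide_distrib table_a_def table_b_def add_divide_distrib)
  also have "(\<Sum>I<100. fst (snd (dual_table ! I)) + snd (snd (dual_table ! I)))
      = sum_list (map (\<lambda>x. fst (snd x) + snd (snd x)) dual_table)"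
    by (simp add: sum_list_sum_nth dual_table_length lessThan_atLeast0)
  also have "real_of_int \<dots> / 2000000 \<le> real_of_int 7737600 / 2000000"
    using dual_table_total by (intro divide_right_mono) (simp_all only: of_int_le_iff)
  finally show "(\<Sum>I<100. (table_a I + table_b I) / 2) \<le> 2418/625" by simp
next
  have "(\<Sum>I<100. real (table_R I - I) * (table_a I + table_b I) / 2 - (table_a I + 2 * table_b I) / 6)
      = real_of_int (balance_units 0 dual_table) / 6000000"
    unfolding balance_units_eq dual_table_length of_int_sum sum_divide_distrib
  proof (rule sum.cong[OF refl])
    fix I :: nat assume "I \<in> {..<100}"
    then have "int I < fst (dual_table ! I)"
      using table_row[of I] by (cases "dual_table ! I") (auto simp: row_ok_def)
    then have n: "real (table_R I - I) = real_of_int (fst (dual_table ! I) - int I)"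
      by (simp add: table_R_def)
    show "real (table_R I - I) * (table_a I + table_b I) / 2 - (table_a I + 2 * table_b I) / 6
      = real_of_int (3 * (fst (dual_table ! I) - (0 + int I)) *
        (fst (snd (dual_table ! I)) + snd (snd (dual_table ! I)))
        - (fst (snd (dual_table ! I)) + 2 * snd (snd (dual_table ! I)))) / 6000000"
      unfolding n by (simp add: table_a_def table_b_def field_simps)
  qed
  moreover have "real_of_int 115800000000 \<le> real_of_int (143 * balance_units 0 dual_table)"
    using dual_table_balance by (simp only: of_int_le_iff)
  ultimately show "real 100 * (193/50) \<le> 143/50 * (\<Sum>I<100. real (table_R I - I) * (table_a I + table_b I) / 2
      - (table_a I + 2 * table_b I) / 6)"
    by simp
qed auto

section \<open>The cost of a single star\<close>

text \<open>Ties in \<open>T\<close> are broken by \<open>t\<close> because the inequality between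
  two clients is needed for every pair in the order. For equal connection times it reads 0 \<le> D i
  + D j + p (t j - t i), which holds if the earlier arrival comes first.\<close>

lemma lexicographic_enumeration:
  fixes T t :: "'i \<Rightarrow> real"
  assumes "finite G"
  shows "\<exists>xs. distinct xs \<and> set xs = G \<and>
    sorted_wrt (\<lambda>i j. T i < T j \<or> T i = T j \<and> t i \<le> t j) xs"
  using assms
proof (induction "card G" arbitrary: G)
  case 0
  then show ?case by (intro exI[of _ "[]"]) auto
next
  case (Suc n)
  define H where "H = {i \<in> G. T i = Min (T ` G)}"
  have "G \<noteq> {}" using Suc.hyps(2) by auto
  then have "Min (T ` G) \<in> T ` G" using Suc.prems by (intro Min_in) auto
  then have H: "finite H" "H \<noteq> {}" "H \<subseteq> G"
    using Suc.prems by (auto simp: H_def)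
  have "Min (t ` H) \<in> t ` H" using H by (intro Min_in) auto
  then obtain i where i: "i \<in> H" "t i = Min (t ` H)" by auto
  have "card (G - {i}) = n" using Suc i H by auto
  then obtain xs where xs: "distinct xs" "set xs = G - {i}"
    "sorted_wrt (\<lambda>i j. T i < T j \<or> T i = T j \<and> t i \<le> t j) xs"
    using Suc.hyps(1)[of "G - {i}"] Suc.prems by auto
  have "T i < T j \<or> T i = T j \<and> t i \<le> t j" if "j \<in> G" for j
  proof -
    have "T i \<le> T j" using i that Suc.prems by (auto simp: H_def)
    moreover have "t i \<le> t j" if "T i = T j"
      using that i \<open>j \<in> G\<close> H by (auto simp: H_def)
    ultimately show ?thesis by linarith
  qed
  then show ?case using xs i H by (intro exI[of _ "i # xs"]) auto
qed

lemma sum_div_blocks: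
  fixes h :: "nat \<Rightarrow> real"
  shows "(\<Sum>m<n * c. h (m div c)) = real c * (\<Sum>j<n. h j)"
proof -
  have "(\<Sum>m<n * c. h (m div c)) = (\<Sum>j<n. \<Sum>m = j * c..<j * c + c. h (m div c))"
    by (rule sum.nat_group[symmetric])
  also have "\<dots> = (\<Sum>j<n. \<Sum>m = j * c..<j * c + c. h j)"
  proof (intro sum.cong refl)
    fix j m assume "m \<in> {j * c..<j * c + c}"
    then have "m div c = j" by (intro div_nat_eqI) (auto simp: mult.commute)
    then show "h (m div c) = h j" by simp
  qed
  finally show ?thesis by (simp add: sum_distrib_left)
qed

lemma star_bound:
  fixes T t D :: "'i \<Rightarrow> real" and f :: real
  assumes G: "finite G" and tT: "\<And>i. i \<in> G \<Longrightarrow> t i \<le> T i" and D: "\<And>i. i \<in> G \<Longrightarrow> 0 \<le> D i"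
    and f: "0 \<le> f"
    and offers: "\<And>i. i \<in> G \<Longrightarrow>
      (\<Sum>j | j \<in> G \<and> T i \<le> T j. max 0 (143/50 * (T i - t j) - D j)) \<le> f"
    and pair: "\<And>i j. i \<in> G \<Longrightarrow> j \<in> G \<Longrightarrow> T i < T j \<Longrightarrow>
      (143/50 - 1) * (T j - T i) \<le> D i + D j + 143/50 * (t j - t i)"
  shows "193/50 * (\<Sum>i\<in>G. T i - t i) \<le> 2418/625 * (f + (\<Sum>i\<in>G. D i + \<bar>t i\<bar>))"
proof (cases "G = {}")
  case False
  obtain xs where xs: "distinct xs" "set xs = G"
    and sorted: "sorted_wrt (\<lambda>i j. T i < T j \<or> T i = T j \<and> t i \<le> t j) xs"
    using lexicographic_enumeration[OF G] by blast
  define n where "n = length xs"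
  have n: "0 < n" using False xs by (auto simp: n_def)
  \<comment> \<open>Each client is copied \<open>c\<close> times, so that the copies split into 100
    blocks of equal size. The factor 8000000 is 8 * 100 / (1/10000), which makes the blocks fine
    enough for the margin.\<close>
  define c :: nat where "c = 100 * 8000000"
  define k where "k = n * 8000000"
  have nc: "n * c = 100 * k" by (simp add: c_def k_def)
  have k: "8 * real 100 \<le> 1/10000 * real k" using n by (simp add: k_def)
  define x where "x = (\<lambda>m. xs ! (m div c))"
  have lt: "m div c < n" if "m < 100 * k" for m
    using that nc by (simp add: div_less_iff_less_mult c_def)
  then have x: "x m \<in> G" if "m < 100 * k" for m
    using that xs by (metis n_def nth_mem x_def)
  have order: "T (xs ! i) < T (xs ! j) \<or> T (xs ! i) = T (xs ! j) \<and> t (xs ! i) \<le> t (xs ! j)"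
    if "i \<le> j" "j < n" for i j
    using that sorted_wrt_nth_less[OF sorted, of i j] by (cases "i = j") (auto simp: n_def)
  have sum_x: "(\<Sum>m<100 * k. h (x m)) = real c * sum h G" for h :: "'i \<Rightarrow> real"
  proof -
    have "(\<Sum>m<100 * k. h (x m)) = real c * (\<Sum>j<n. h (xs ! j))"
      unfolding nc[symmetric] x_def using sum_div_blocks[of "\<lambda>j. h (xs ! j)" c n] by simp
    also have "(\<Sum>j<n. h (xs ! j)) = sum h G"
      using sum.distinct_set_conv_list[OF xs(1), of h] xs(2)
      by (simp add: n_def sum_list_sum_nth lessThan_atLeast0)
    finally show ?thesis .
  qed
  have "193/50 * (\<Sum>m<100 * k. T (x m) - t (x m))
      \<le> 2418/625 * (real c * f + (\<Sum>m<100 * k. D (x m) + \<bar>t (x m)\<bar>))"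
  proof (rule table.items_bound[OF k])
    fix m r assume m: "m < 100 * k" and r: "r \<le> 100 * k"
    define h where "h = (\<lambda>j. max 0 (143/50 * (T (x m) - t j) - D j))"
    have "143/50 * real (r - m) * T (x m) - (\<Sum>i = m..<r. 143/50 * t (x i) + D (x i))
        = (\<Sum>i = m..<r. 143/50 * (T (x m) - t (x i)) - D (x i))"
      by (simp add: sum_subtractf sum.distrib right_diff_distrib sum_distrib_left)
    also have "\<dots> \<le> (\<Sum>i = m..<r. if T (x m) \<le> T (x i) then h (x i) else 0)"
    proof (rule sum_mono)
      fix i assume i: "i \<in> {m..<r}"
      have "T (x m) \<le> T (x i)"
        using order[of "m div c" "i div c"] i r lt[of i] by (auto simp: x_def div_le_mono)
      then show "143/50 * (T (x m) - t (x i)) - D (x i) \<le> (if T (x m) \<le> T (x i) then h (x i) else 0)"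
        by (simp add: h_def)
    qed
    \<comment> \<open>Clients beyond \<open>r\<close> are added, and so are copies before
      \<open>m\<close> with the same connection time. This is possible because the offers have been
      replaced by their positive parts.\<close>
    also have "\<dots> \<le> (\<Sum>i<100 * k. if T (x m) \<le> T (x i) then h (x i) else 0)"
      using r by (intro sum_mono2) (auto simp: h_def)
    also have "\<dots> = real c * (\<Sum>j\<in>G. if T (x m) \<le> T j then h j else 0)"
      by (rule sum_x)
    also have "(\<Sum>j\<in>G. if T (x m) \<le> T j then h j else 0) = (\<Sum>j | j \<in> G \<and> T (x m) \<le> T j. h j)"
      using G by (rule sum.inter_filter[symmetric])
    also have "real c * \<dots> \<le> real c * f"
      using offers[OF x[OF m]] by (intro mult_left_mono) (auto simp: h_def)
    finally show "143/50 * real (r - m) * T (x m) - (\<Sum>i = m..<r. 143/50 * t (x i) + D (x i)) \<le> real c * f" .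
  next
    fix i j assume ij: "i < j" "j < 100 * k"
    have xG: "x i \<in> G" "x j \<in> G" using x ij by auto
    show "(143/50 - 1) * (T (x j) - T (x i)) \<le> D (x i) + D (x j) + 143/50 * (t (x j) - t (x i))"
    proof (cases "T (x i) < T (x j)")
      case False
      then have "T (x i) = T (x j)" "t (x i) \<le> t (x j)"
        using order[of "i div c" "j div c"] ij lt[of j] by (auto simp: x_def div_le_mono)
      then show ?thesis using D xG by simp
    qed (use pair xG in auto)
  qed (use tT D f x in auto)
  then have "real c * (193/50 * (\<Sum>i\<in>G. T i - t i))
      \<le> real c * (2418/625 * (f + (\<Sum>i\<in>G. D i + \<bar>t i\<bar>)))"
    unfolding sum_x[of "\<lambda>i. T i - t i"] sum_x[of "\<lambda>i. D i + \<bar>t i\<bar>"] by (simp add: algebra_simps)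
  then show ?thesis by (rule mult_left_le_imp_le) (simp add: c_def)
qed (use f in simp)

section \<open>Scheduling by growing offers\<close>

text \<open>In the application \<open>p\<close> is \<gamma> - 1: the client's own waiting is already
  deducted. As \<open>p\<close> exceeds 1, a budget outgrows the facility-side waiting, and every
  open facility comes within reach eventually.\<close>

locale offers =
  fixes Y :: "'a set" and g :: "'a \<Rightarrow> real" and d :: "nat \<Rightarrow> 'a \<Rightarrow> real"
    and t e :: "nat \<Rightarrow> real" and p :: real
  assumes Y: "Y \<noteq> {}" and g: "\<And>y. y \<in> Y \<Longrightarrow> 0 \<le> g y"
    and d: "\<And>j y. y \<in> Y \<Longrightarrow> 0 \<le> d j y" and e: "\<And>j. 0 < e j" and p: "1 < p"
begin

definition offer :: "nat \<Rightarrow> 'a \<Rightarrow> real \<Rightarrow> real" where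
  "offer j y s = max 0 (p * (s - t j) - d j y)"

text \<open>
  A schedule assigns a connection time \<open>T j\<close> and a facility \<open>F j\<close> to each client of \<open>P - A\<close>, while the
  clients of \<open>A\<close> are still waiting. The last conjunct says that the clients connected at the opening of a
  facility pay for it; their errors \<open>e\<close> are needed because an earliest time to open may not exist.
\<close>

definition served :: "nat set \<Rightarrow> nat set \<Rightarrow> (nat \<Rightarrow> real) \<Rightarrow> (nat \<Rightarrow> 'a facility) \<Rightarrow> bool" where
  "served P A T F \<longleftrightarrow> (\<forall>j \<in> P - A.
     t j \<le> T j \<and> location (F j) \<in> Y \<and> opening_time (F j) \<le> T j \<and>
     d j (location (F j)) + (T j - opening_time (F j)) \<le> p * (T j - t j) + e j \<and>
     (\<exists>i \<in> P - A. F i = F j \<and> T i = opening_time (F j)) \<and>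
     (\<forall>i \<in> P - A. opening_time (F i) < T j \<longrightarrow>
        p * (T j - t j) \<le> d j (location (F i)) + (T j - opening_time (F i))) \<and>
     (\<forall>y \<in> Y. (\<Sum>i | i \<in> P \<and> (i \<in> A \<or> T j \<le> T i). offer i y (T j)) \<le> g y) \<and>
     g (location (F j)) + (\<Sum>i | i \<in> P - A \<and> F i = F j \<and> T i = opening_time (F j).
        d i (location (F j)) - p * (T i - t i) - e i) \<le> 0)"

text \<open>The state from which a run can continue at time \<open>s\<close>. Clients connected
  exactly at \<open>s\<close> still count among the offers, since further connections at time
  \<open>s\<close> must satisfy a bound that includes them.\<close>

definition active_at ::
  "real \<Rightarrow> nat set \<Rightarrow> nat set \<Rightarrow> (nat \<Rightarrow> real) \<Rightarrow> (nat \<Rightarrow> 'a facility) \<Rightarrow> bool" where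
  "active_at s P A T F \<longleftrightarrow>
     (\<forall>j \<in> P. t j \<le> s) \<and> (\<forall>j \<in> P - A. T j \<le> s) \<and>
     (\<forall>j \<in> A. \<forall>i \<in> P - A. p * (s - t j) \<le> d j (location (F i)) + (s - opening_time (F i))) \<and>
     (\<forall>y \<in> Y. (\<Sum>i | i \<in> P \<and> (i \<in> A \<or> s \<le> T i). offer i y s) \<le> g y)"

lemma offer_nonneg: "0 \<le> offer j y s"
  by (simp add: offer_def)

lemma offer_mono: "s \<le> s' \<Longrightarrow> offer j y s \<le> offer j y s'"
proof -
  assume "s \<le> s'"
  then have "p * (s - t j) \<le> p * (s' - t j)" using p by (intro mult_left_mono) auto
  then show ?thesis unfolding offer_def by linarith
qed

lemma serve_group:
  assumes P: "finite P" and A: "A \<subseteq> P" and served: "served P A T F" and active: "active_at s P A T F"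
    and J: "J \<subseteq> A" "J \<noteq> {}" and u: "s \<le> u" and f: "location f \<in> Y" "opening_time f \<le> u"
    and budget: "\<And>j. j \<in> J \<Longrightarrow> d j (location f) + (u - opening_time f) \<le> p * (u - t j) + e j"
    and reach: "\<And>j i. j \<in> A \<Longrightarrow> i \<in> P - A \<Longrightarrow>
      p * (u - t j) \<le> d j (location (F i)) + (u - opening_time (F i))"
    and bids: "\<And>y. y \<in> Y \<Longrightarrow> (\<Sum>i | i \<in> P \<and> (i \<in> A \<or> u \<le> T i). offer i y u) \<le> g y"
    and left: "\<And>j. j \<in> A - J \<Longrightarrow> p * (u - t j) \<le> d j (location f) + (u - opening_time f)"
    and paid: "f \<in> F ` (P - A) \<or> opening_time f = u \<and>
      g (location f) + (\<Sum>j\<in>J. d j (location f) - p * (u - t j) - e j) \<le> 0"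
  defines "T' \<equiv> \<lambda>j. if j \<in> J then u else T j" and "F' \<equiv> \<lambda>j. if j \<in> J then f else F j"
  shows "served P (A - J) T' F' \<and> active_at u P (A - J) T' F'"
proof -
  have PAJ: "P - (A - J) = (P - A) \<union> J" using J A by auto
  have K: "T' i = T i" "F' i = F i" if "i \<in> P - A" for i
    using that J by (auto simp: T'_def F'_def)
  have JT: "T' i = u" "F' i = f" if "i \<in> J" for i
    using that by (auto simp: T'_def F'_def)
  have Ks: "T i \<le> s" if "i \<in> P - A" for i
    using active that by (auto simp: active_at_def)
  \<comment> \<open>Up to time \<open>u\<close> it makes no difference to the offers whether a
    client is waiting or is connected at \<open>u\<close>; hence all earlier bounds on offers
    persist.\<close>
  have sets: "{i. i \<in> P \<and> (i \<in> A - J \<or> r \<le> T' i)} = {i. i \<in> P \<and> (i \<in> A \<or> r \<le> T i)}" if "r \<le> u" for r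
    using that J by (auto simp: T'_def)
  define v where "v = (\<lambda>j h. d j h - p * (T' j - t j) - e j)"
  have vJ: "v j (location f) \<le> 0" if "j \<in> J" for j
    using budget[OF that] f(2) by (simp add: v_def JT[OF that])
  have vK: "v j (location (F j)) \<le> 0" if "j \<in> P - A" for j
  proof -
    have "opening_time (F j) \<le> T j"
      "d j (location (F j)) + (T j - opening_time (F j)) \<le> p * (T j - t j) + e j"
      using served that unfolding served_def by blast+
    then show ?thesis using K[OF that] by (simp add: v_def)
  qed
  have fin: "finite J" by (rule finite_subset[OF J(1) finite_subset[OF A P]])
  have "t j \<le> T' j \<and> location (F' j) \<in> Y \<and> opening_time (F' j) \<le> T' j \<and>
     d j (location (F' j)) + (T' j - opening_time (F' j)) \<le> p * (T' j - t j) + e j \<and>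
     (\<exists>i \<in> P - A \<union> J. F' i = F' j \<and> T' i = opening_time (F' j)) \<and>
     (\<forall>i \<in> P - A \<union> J. opening_time (F' i) < T' j \<longrightarrow>
        p * (T' j - t j) \<le> d j (location (F' i)) + (T' j - opening_time (F' i))) \<and>
     (\<forall>y \<in> Y. (\<Sum>i | i \<in> P \<and> (i \<in> A - J \<or> T' j \<le> T' i). offer i y (T' j)) \<le> g y) \<and>
     g (location (F' j)) + (\<Sum>i | i \<in> P - A \<union> J \<and> F' i = F' j \<and> T' i = opening_time (F' j).
        d i (location (F' j)) - p * (T' i - t i) - e i) \<le> 0"
    if j: "j \<in> P - A \<union> J" for j
  proof (intro conjI)
    note sj = served[unfolded served_def, rule_format]
    have "j \<in> P" using j J A by auto
    then have "t j \<le> s" using active unfolding active_at_def by blast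
    then have tu: "t j \<le> u" using u by simp
    show "t j \<le> T' j" "location (F' j) \<in> Y" "opening_time (F' j) \<le> T' j"
      "d j (location (F' j)) + (T' j - opening_time (F' j)) \<le> p * (T' j - t j) + e j"
      using j sj[of j] f budget[of j] tu K[of j] JT[of j] by auto
    show "\<exists>i \<in> P - A \<union> J. F' i = F' j \<and> T' i = opening_time (F' j)"
    proof (cases "F' j \<in> F ` (P - A)")
      case True
      then obtain i where i: "i \<in> P - A" "F i = F' j" by auto
      then obtain i' where "i' \<in> P - A" "F i' = F i" "T i' = opening_time (F i)"
        using sj[of i] by blast
      then show ?thesis using K[of i'] i by (intro bexI[of _ i']) auto
    next
      case False
      then have "j \<in> J" using j K by (metis UnE imageI)
      then show ?thesis using False paid JT[of j] j by (intro bexI[of _ j]) auto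
    qed
    show "\<forall>i \<in> P - A \<union> J. opening_time (F' i) < T' j \<longrightarrow>
        p * (T' j - t j) \<le> d j (location (F' i)) + (T' j - opening_time (F' i))"
    proof (intro ballI impI)
      fix i assume i: "i \<in> P - A \<union> J" and lt: "opening_time (F' i) < T' j"
      have "T' j \<le> u" using j JT[of j] K[of j] Ks[of j] u by auto
      then have "F' i \<in> F ` (P - A)"
        using i lt paid JT[of i] K[of i] by auto
      then obtain i' where i': "i' \<in> P - A" "F' i = F i'" by auto
      show "p * (T' j - t j) \<le> d j (location (F' i)) + (T' j - opening_time (F' i))"
        using j sj[of j] reach[of j i'] i' lt J K[of j] JT[of j] by auto
    qed
    show "\<forall>y \<in> Y. (\<Sum>i | i \<in> P \<and> (i \<in> A - J \<or> T' j \<le> T' i). offer i y (T' j)) \<le> g y"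
    proof (cases "j \<in> J")
      case True
      then show ?thesis using bids sets[of u] JT[of j] by auto
    next
      case False
      then have "j \<in> P - A" using j by auto
      moreover from this have "T' j \<le> u" using Ks[of j] u K[of j] by auto
      ultimately show ?thesis using sj[of j] sets[of "T' j"] K[of j] by auto
    qed
    show "g (location (F' j)) + (\<Sum>i | i \<in> P - A \<union> J \<and> F' i = F' j \<and> T' i = opening_time (F' j).
        d i (location (F' j)) - p * (T' i - t i) - e i) \<le> 0"
    proof -
      \<comment> \<open>A group may join a facility at the very moment of its opening and so enter
        the sum of those who pay for it. The terms it adds are nonpositive by \<open>budget\<close>,
        so the opening remains paid for.\<close>
      define S where "S = (\<lambda>M. {i. i \<in> M \<and> F' i = F' j \<and> T' i = opening_time (F' j)})"
      have "S (P - A \<union> J) = S (P - A) \<union> S J" "S (P - A) \<inter> S J = {}"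
        using J by (auto simp: S_def)
      then have split: "(\<Sum>i\<in>S (P - A \<union> J). v i (location (F' j)))
          = (\<Sum>i\<in>S (P - A). v i (location (F' j))) + (\<Sum>i\<in>S J. v i (location (F' j)))"
        using P fin by (simp add: S_def sum.union_disjoint)
      have "v i (location (F' j)) \<le> 0" if "i \<in> S (P - A)" for i
        using vK[of i] K(2)[of i] that by (simp add: S_def)
      moreover have "v i (location (F' j)) \<le> 0" if "i \<in> S J" for i
        using vJ[of i] JT(2)[of i] that by (simp add: S_def)
      ultimately have neg: "(\<Sum>i\<in>S (P - A). v i (location (F' j))) \<le> 0"
        "(\<Sum>i\<in>S J. v i (location (F' j))) \<le> 0"
        by (simp_all add: sum_nonpos)
      have "g (location (F' j)) + (\<Sum>i\<in>S (P - A). v i (location (F' j))) \<le> 0 \<or>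
            g (location (F' j)) + (\<Sum>i\<in>S J. v i (location (F' j))) \<le> 0"
      proof (cases "F' j \<in> F ` (P - A)")
        case True
        then obtain i where i: "i \<in> P - A" "F' j = F i" by auto
        have "S (P - A) = {i'. i' \<in> P - A \<and> F i' = F i \<and> T i' = opening_time (F i)}"
          unfolding S_def using K i by auto
        moreover have "v i' (location (F i)) = d i' (location (F i)) - p * (T i' - t i') - e i'"
          if "i' \<in> S (P - A)" for i'
          using K[of i'] that by (auto simp: v_def S_def)
        ultimately show ?thesis using sj[OF i(1)] i by auto
      next
        case False
        then have jJ: "j \<in> J" using j K by (metis UnE imageI)
        then have "opening_time f = u" "S J = J"
          using False paid JT by (auto simp: S_def)
        moreover have "v i (location f) = d i (location f) - p * (u - t i) - e i" if "i \<in> J" for i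
          using JT[OF that] by (simp add: v_def)
        ultimately show ?thesis using False paid JT[OF jJ] by auto
      qed
      then show ?thesis using split neg unfolding S_def v_def by linarith
    qed
  qed
  then have "served P (A - J) T' F'" unfolding served_def PAJ by blast
  moreover have "active_at u P (A - J) T' F'"
    unfolding active_at_def PAJ
  proof (intro conjI ballI)
    fix j assume "j \<in> P"
    then have "t j \<le> s" using active unfolding active_at_def by blast
    then show "t j \<le> u" using u by simp
  next
    fix j assume "j \<in> P - A \<union> J" then show "T' j \<le> u" using Ks[of j] u JT[of j] K[of j] by auto
  next
    fix j i assume "j \<in> A - J" "i \<in> P - A \<union> J"
    then show "p * (u - t j) \<le> d j (location (F' i)) + (u - opening_time (F' i))"
      using left[of j] reach[of j i] JT[of i] K[of i] by auto
  next
    fix y assume "y \<in> Y"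
    then show "(\<Sum>i | i \<in> P \<and> (i \<in> A - J \<or> u \<le> T' i). offer i y u) \<le> g y"
      using bids sets[of u] by simp
  qed
  ultimately show ?thesis by blast
qed

text \<open>The next event is the earliest crossing with an open facility if it comes no later than
  \<open>u0\<close>, and otherwise the opening of a site. The site is opened at \<open>u0\<close>,
  not at the later time \<open>r\<close> when it is overpaid: at \<open>u0\<close> no site is
  overpaid, as the analysis of stars demands, and the amount missing is covered by the
  errors.\<close>

lemma exists_group:
  assumes P: "finite P" and A: "A \<subseteq> P" "A \<noteq> {}" and served: "served P A T F"
    and active: "active_at s P A T F"
  shows "\<exists>J u f. J \<subseteq> A \<and> J \<noteq> {} \<and> s \<le> u \<and>
    served P (A - J) (\<lambda>j. if j \<in> J then u else T j) (\<lambda>j. if j \<in> J then f else F j) \<and>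
    active_at u P (A - J) (\<lambda>j. if j \<in> J then u else T j) (\<lambda>j. if j \<in> J then f else F j)"
proof -
  have finA: "finite A" by (rule finite_subset[OF A(1) P])
  define total where "total = (\<lambda>y r. \<Sum>j\<in>A. offer j y r)"
  \<comment> \<open>The excess is strict, so by continuity no site is overpaid at the infimum
    itself.\<close>
  define V where "V = {r. s \<le> r \<and> (\<exists>y\<in>Y. g y < total y r)}"
  define u0 where "u0 = Inf V"
  obtain y0 where y0: "y0 \<in> Y" using Y by blast
  obtain j0 where j0: "j0 \<in> A" using A by blast
  have "V \<noteq> {}"
  proof -
    define r where "r = max s (t j0 + (d j0 y0 + g y0 + 1) / p)"
    have "d j0 y0 + g y0 + 1 = p * ((d j0 y0 + g y0 + 1) / p)" using p by simp
    also have "\<dots> \<le> p * (r - t j0)" using p by (intro mult_left_mono) (auto simp: r_def)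
    finally have "g y0 < offer j0 y0 r" by (simp add: offer_def)
    also have "\<dots> \<le> total y0 r"
      unfolding total_def using j0 finA by (intro member_le_sum) (auto simp: offer_nonneg)
    finally have "r \<in> V" using y0 by (auto simp: V_def r_def)
    then show ?thesis by blast
  qed
  have bdd: "bdd_below V" by (auto simp: V_def bdd_below_def)
  have u0: "s \<le> u0" unfolding u0_def using \<open>V \<noteq> {}\<close> by (intro cInf_greatest) (auto simp: V_def)
  have at_s: "(\<Sum>i | i \<in> P \<and> (i \<in> A \<or> s \<le> T i). offer i y s) \<le> g y" if "y \<in> Y" for y
    using active that by (auto simp: active_at_def)
  have total_le: "total y r \<le> g y" if r: "s \<le> r" "r \<le> u0" and y: "y \<in> Y" for y r
  proof (rule ccontr)
    assume "\<not> total y r \<le> g y"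
    then have gt: "g y < total y r" by simp
    have rs: "s < r"
    proof (rule ccontr)
      assume "\<not> s < r"
      then have "r = s" using r by simp
      moreover have "total y s \<le> (\<Sum>i | i \<in> P \<and> (i \<in> A \<or> s \<le> T i). offer i y s)"
        unfolding total_def using A P by (intro sum_mono2) (auto simp: offer_nonneg)
      ultimately show False using gt at_s[OF y] by simp
    qed
    have "isCont (total y) r" unfolding total_def offer_def by (intro continuous_intros)
    then have "\<forall>\<^sub>F x in at r. g y < total y x"
      using gt by (auto simp: isCont_def intro: order_tendstoD)
    then obtain \<delta> where \<delta>: "0 < \<delta>" "\<And>x. x \<noteq> r \<Longrightarrow> dist x r < \<delta> \<Longrightarrow> g y < total y x"
      by (auto simp: eventually_at)
    define x where "x = max s (r - \<delta> / 2)"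
    have x: "x < r" "s \<le> x" "dist x r < \<delta>" using \<delta>(1) rs by (auto simp: x_def dist_real_def)
    then have "x \<in> V" using \<delta>(2)[of x] y by (auto simp: V_def)
    then have "u0 \<le> x" unfolding u0_def by (intro cInf_lower bdd)
    then show False using x r by simp
  qed
  have bids: "(\<Sum>i | i \<in> P \<and> (i \<in> A \<or> r \<le> T i). offer i y r) \<le> g y"
    if r: "s \<le> r" "r \<le> u0" and y: "y \<in> Y" for y r
  proof (cases "r = s")
    case False
    have "T i \<le> s" if "i \<in> P - A" for i
      using active that unfolding active_at_def by blast
    then have "{i. i \<in> P \<and> (i \<in> A \<or> r \<le> T i)} = A"
      using False r A by fastforce
    then show ?thesis using total_le[OF r y] by (simp add: total_def)
  qed (use at_s y in simp)
  \<comment> \<open>The budget has slope \<open>p\<close> > 1 and the facility-side waiting slope 1,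
    so there is exactly one moment at which facility \<open>F i\<close> comes within reach of client
    \<open>j\<close>.\<close>
  define cross where "cross = (\<lambda>(j, i). (d j (location (F i)) + p * t j - opening_time (F i)) / (p - 1))"
  have cross: "p * (r - t j) \<le> d j (location (F i)) + (r - opening_time (F i)) \<longleftrightarrow> r \<le> cross (j, i)"
    and cross_eq: "p * (cross (j, i) - t j) = d j (location (F i)) + (cross (j, i) - opening_time (F i))" for r j i
    using p by (auto simp: cross_def field_simps)
  have facility: "location (F i) \<in> Y" "opening_time (F i) \<le> s" if "i \<in> P - A" for i
  proof -
    show "location (F i) \<in> Y" using served that unfolding served_def by blast
    have "opening_time (F i) \<le> T i" using served that unfolding served_def by blast
    also have "T i \<le> s" using active that unfolding active_at_def by blast
    finally show "opening_time (F i) \<le> s" .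
  qed
  show ?thesis
  proof (cases "\<exists>x \<in> A \<times> (P - A). cross x \<le> u0")
    case True
    define u where "u = Min (cross ` (A \<times> (P - A)))"
    have finC: "finite (cross ` (A \<times> (P - A)))" using finA P by auto
    have "u \<in> cross ` (A \<times> (P - A))" unfolding u_def using finC True by (intro Min_in) auto
    then obtain j i where ji: "j \<in> A" "i \<in> P - A" "u = cross (j, i)" by auto
    have le: "u \<le> cross (j', i')" if "j' \<in> A" "i' \<in> P - A" for j' i'
      unfolding u_def using finC that by (intro Min_le) auto
    have "s \<le> u" using active ji cross[of s j i] by (auto simp: active_at_def)
    moreover have "u \<le> u0" using True le by force
    moreover have "opening_time (F i) \<le> u" using facility[OF ji(2)] \<open>s \<le> u\<close> by simp
    ultimately have "served P (A - {j}) (\<lambda>k. if k \<in> {j} then u else T k) (\<lambda>k. if k \<in> {j} then F i else F k) \<and>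
      active_at u P (A - {j}) (\<lambda>k. if k \<in> {j} then u else T k) (\<lambda>k. if k \<in> {j} then F i else F k)"
      using ji facility[OF ji(2)] le e[of j]
      by (intro serve_group[OF P A(1) served active])
         (auto simp: cross cross_eq bids intro: less_imp_le)
    then show ?thesis using ji(1) \<open>s \<le> u\<close>
      by (intro exI[of _ "{j}"] exI[of _ u] exI[of _ "F i"]) blast
  next
    case False
    \<comment> \<open>Within this time a budget grows by at most the smallest error.\<close>
    define \<delta> where "\<delta> = Min (e ` A) / p"
    have "0 < Min (e ` A)" using finA A e by (subst Min_gr_iff) auto
    then have "0 < \<delta>" using p by (simp add: \<delta>_def)
    then obtain r where "r \<in> V" and r: "r < u0 + \<delta>"
      using cInf_lessD[OF \<open>V \<noteq> {}\<close>, of "u0 + \<delta>"] by (auto simp: u0_def)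
    then obtain y where y: "y \<in> Y" "g y < total y r" by (auto simp: V_def)
    have ur: "u0 \<le> r" unfolding u0_def using \<open>r \<in> V\<close> by (intro cInf_lower bdd)
    have pe: "p * (r - u0) \<le> e j" if "j \<in> A" for j
    proof -
      have "p * (r - u0) \<le> p * \<delta>" using r p by (intro mult_left_mono) auto
      also have "\<dots> = Min (e ` A)" using p by (simp add: \<delta>_def)
      also have "\<dots> \<le> e j" using that finA by simp
      finally show ?thesis .
    qed
    \<comment> \<open>The clients with a positive offer to \<open>y\<close> at time
      \<open>r\<close>. The others offer nothing at \<open>r\<close>, so at the earlier time
      \<open>u0\<close> they cannot reach the new facility prematurely.\<close>
    define J where "J = {j \<in> A. d j y < p * (r - t j)}"
    have total_J: "total y r = (\<Sum>j\<in>J. p * (r - t j) - d j y)"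
      unfolding total_def J_def offer_def using finA
      by (subst sum.inter_filter) (auto intro!: sum.cong)
    also have "\<dots> \<le> (\<Sum>j\<in>J. p * (u0 - t j) + e j - d j y)"
      using pe by (intro sum_mono) (auto simp: J_def algebra_simps)
    finally have paid: "g y + (\<Sum>j\<in>J. d j y - p * (u0 - t j) - e j) \<le> 0"
      using y by (simp add: sum_subtractf sum.distrib)
    have J: "J \<subseteq> A" by (auto simp: J_def)
    have J0: "J \<noteq> {}"
    proof
      assume "J = {}"
      then show False using total_J y g[of y] by simp
    qed
    have near: "d j y \<le> p * (u0 - t j) + e j" if "j \<in> J" for j
      using pe[of j] that by (auto simp: J_def algebra_simps)
    have far: "p * (u0 - t j) \<le> d j y" if "j \<in> A - J" for j
    proof -
      have "p * (u0 - t j) \<le> p * (r - t j)" using ur p by (intro mult_left_mono) auto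
      moreover have "\<not> d j y < p * (r - t j)" using that by (auto simp: J_def)
      ultimately show ?thesis by linarith
    qed
    have reach: "u0 \<le> cross (k, i)" if "k \<in> A" "i \<in> P - A" for k i
      using False that by force
    have "served P (A - J) (\<lambda>k. if k \<in> J then u0 else T k) (\<lambda>k. if k \<in> J then (y, u0) else F k) \<and>
      active_at u0 P (A - J) (\<lambda>k. if k \<in> J then u0 else T k) (\<lambda>k. if k \<in> J then (y, u0) else F k)"
      by (rule serve_group[OF P A(1) served active J J0 u0])
         (use y u0 paid near far reach in \<open>auto simp: cross bids\<close>)
    then show ?thesis using J J0 u0 by (intro exI[of _ J] exI[of _ u0] exI[of _ "(y, u0)"]) blast
  qed
qed

text \<open>The run ends because every event connects at least one waiting client.\<close>

lemma continuation:
  assumes "finite P" "A \<subseteq> P" "served P A T F" "active_at s P A T F"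
  shows "\<exists>T' F'. served P {} T' F' \<and> (\<forall>j \<in> P - A. T' j = T j \<and> F' j = F j) \<and> (\<forall>j \<in> A. s \<le> T' j)"
  using assms
proof (induction "card A" arbitrary: A T F s rule: less_induct)
  case less
  show ?case
  proof (cases "A = {}")
    case False
    obtain J u f where J: "J \<subseteq> A" "J \<noteq> {}" and u: "s \<le> u"
      and *: "served P (A - J) (\<lambda>j. if j \<in> J then u else T j) (\<lambda>j. if j \<in> J then f else F j)"
        "active_at u P (A - J) (\<lambda>j. if j \<in> J then u else T j) (\<lambda>j. if j \<in> J then f else F j)"
      using exists_group[OF less.prems(1,2) False less.prems(3,4)] by blast
    have "card (A - J) < card A"
      using J less.prems by (intro psubset_card_mono) (auto intro: finite_subset)
    then obtain T' F' where 1: "served P {} T' F'"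
      and 2: "\<forall>j \<in> P - (A - J). T' j = (if j \<in> J then u else T j) \<and> F' j = (if j \<in> J then f else F j)"
      and 3: "\<forall>j \<in> A - J. u \<le> T' j"
      using less.hyps[of "A - J", OF _ less.prems(1) _ *] less.prems(2) by auto
    have "s \<le> T' j" if "j \<in> A" for j
      using 2 3 u that less.prems(2) by (cases "j \<in> J") force+
    moreover have "T' j = T j \<and> F' j = F j" if "j \<in> P - A" for j
      using 2 that J by auto
    ultimately show ?thesis using 1 by blast
  qed (use less.prems in auto)
qed

text \<open>All connections at time \<open>s\<close> or later are revoked. A facility with a
  remaining client was opened before \<open>s\<close>, so everyone who pays for it remains connected
  too; the newcomer offers nothing up to \<open>s\<close>.\<close>

lemma new_client:
  assumes P: "finite P" and served: "served P {} T F" and n: "n \<notin> P"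
    and tn: "t n = s" and ts: "\<And>j. j \<in> P \<Longrightarrow> t j \<le> s"
  defines "A \<equiv> insert n {j \<in> P. s \<le> T j}"
  shows "served (insert n P) A T F \<and> active_at s (insert n P) A T F"
proof -
  note sj = served[unfolded served_def Diff_empty empty_iff HOL.simp_thms, rule_format]
  have K: "insert n P - A = {j \<in> P. T j < s}" using n by (auto simp: A_def)
  have offer_n: "offer n y r = 0" if "r \<le> s" "y \<in> Y" for y r
  proof -
    have "p * (r - t n) \<le> 0" using that p tn by (simp add: mult_le_0_iff)
    then show ?thesis using d[OF that(2), of n] by (simp add: offer_def)
  qed
  have bids: "(\<Sum>i | i \<in> insert n P \<and> (i \<in> A \<or> r \<le> T i). offer i y r) = (\<Sum>i | i \<in> P \<and> r \<le> T i. offer i y r)"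
    if "r \<le> s" "y \<in> Y" for y r
  proof -
    have "{i. i \<in> insert n P \<and> (i \<in> A \<or> r \<le> T i)} = insert n {i. i \<in> P \<and> r \<le> T i}"
      using that by (auto simp: A_def)
    then show ?thesis using P n offer_n[OF that] by simp
  qed
  have "served (insert n P) A T F"
    unfolding served_def K
  proof (intro ballI conjI)
    fix j assume "j \<in> {j \<in> P. T j < s}"
    then have j: "j \<in> P" "T j < s" by auto
    show "t j \<le> T j" "location (F j) \<in> Y" "opening_time (F j) \<le> T j"
      "d j (location (F j)) + (T j - opening_time (F j)) \<le> p * (T j - t j) + e j"
      using sj[OF j(1)] by auto
    then show "\<exists>i \<in> {j \<in> P. T j < s}. F i = F j \<and> T i = opening_time (F j)"
      using sj[OF j(1)] j by fastforce
    have "{i. i \<in> {j \<in> P. T j < s} \<and> F i = F j \<and> T i = opening_time (F j)}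
        = {i. i \<in> P \<and> F i = F j \<and> T i = opening_time (F j)}"
      using \<open>opening_time (F j) \<le> T j\<close> j by auto
    then show "g (location (F j)) + (\<Sum>i | i \<in> {j \<in> P. T j < s} \<and> F i = F j \<and> T i = opening_time (F j).
        d i (location (F j)) - p * (T i - t i) - e i) \<le> 0"
      using sj[OF j(1)] by simp
    show "opening_time (F i) < T j \<longrightarrow> p * (T j - t j) \<le> d j (location (F i)) + (T j - opening_time (F i))"
      if "i \<in> {j \<in> P. T j < s}" for i
      using sj[OF j(1)] that by auto
    show "(\<Sum>i | i \<in> insert n P \<and> (i \<in> A \<or> T j \<le> T i). offer i y (T j)) \<le> g y" if "y \<in> Y" for y
      using bids[OF less_imp_le[OF j(2)] that] sj[OF j(1)] that by auto
  qed
  moreover have "active_at s (insert n P) A T F"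
    unfolding active_at_def K
  proof (intro ballI conjI)
    show "t j \<le> s" if "j \<in> insert n P" for j using that tn ts by auto
    show "T j \<le> s" if "j \<in> {j \<in> P. T j < s}" for j using that by auto
  next
    fix j i assume j: "j \<in> A" and "i \<in> {j \<in> P. T j < s}"
    then have i: "i \<in> P" "T i < s" by auto
    have i': "opening_time (F i) < s" "location (F i) \<in> Y" using sj[OF i(1)] i by auto
    show "p * (s - t j) \<le> d j (location (F i)) + (s - opening_time (F i))"
    proof (cases "j = n")
      case True
      then show ?thesis using tn i' d[OF i'(2), of n] by simp
    next
      case False
      then have j: "j \<in> P" "s \<le> T j" using j by (auto simp: A_def)
      then have "p * (T j - t j) \<le> d j (location (F i)) + (T j - opening_time (F i))"
        using sj[OF j(1)] i i' by auto
      \<comment> \<open>The facility is out of reach at \<open>T j\<close>. Going back to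
        \<open>s\<close> lowers the budget at rate \<open>p\<close> but the facility-side waiting
        only at rate 1, so it was out of reach at \<open>s\<close> as well.\<close>
      moreover have "1 * (T j - s) \<le> p * (T j - s)" using j p by (intro mult_right_mono) auto
      ultimately show ?thesis by (simp add: algebra_simps)
    qed
  next
    fix y assume y: "y \<in> Y"
    define Q where "Q = {i. i \<in> P \<and> s \<le> T i}"
    have "(\<Sum>i\<in>Q. offer i y s) \<le> g y"
    proof (cases "Q = {}")
      case False
      have finQ: "finite Q" using P by (simp add: Q_def)
      \<comment> \<open>At the earliest revoked connection the bound on the offers involves all of
        \<open>Q\<close>; offers are monotone in time, so it also holds at \<open>s\<close>.\<close>
      have "Min (T ` Q) \<in> T ` Q" using finQ False by (intro Min_in) auto
      then obtain k where k: "k \<in> Q" "T k = Min (T ` Q)" by auto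
      then have le: "T k \<le> T i" if "i \<in> Q" for i using that finQ by simp
      have kP: "k \<in> P" "s \<le> T k" using k by (auto simp: Q_def)
      then have "Q = {i. i \<in> P \<and> T k \<le> T i}" using le by (auto simp: Q_def)
      then have "(\<Sum>i\<in>Q. offer i y (T k)) \<le> g y" using sj[OF kP(1)] y by auto
      moreover have "(\<Sum>i\<in>Q. offer i y s) \<le> (\<Sum>i\<in>Q. offer i y (T k))"
        by (intro sum_mono offer_mono kP)
      ultimately show ?thesis by simp
    qed (use g y in simp)
    then show "(\<Sum>i | i \<in> insert n P \<and> (i \<in> A \<or> s \<le> T i). offer i y s) \<le> g y"
      using bids[OF order_refl y] by (simp add: Q_def)
  qed
  ultimately show ?thesis by blast
qed

end

lemma served_cong:
  assumes "offers Y g d e p" "offers Y g d' e' p"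
    and "\<And>j. j \<in> P \<Longrightarrow> d' j = d j \<and> t' j = t j \<and> e' j = e j \<and> T' j = T j \<and> F' j = F j"
  shows "offers.served Y g d' t' e' p P {} T' F' \<longleftrightarrow> offers.served Y g d t e p P {} T F"
  using assms(3) unfolding offers.served_def[OF assms(1)] offers.served_def[OF assms(2)]
    offers.offer_def[OF assms(1)] offers.offer_def[OF assms(2)]
  by (simp cong: sum.cong_simp conj_cong ball_cong bex_cong)

section \<open>The online algorithm\<close>

definition finite_sites :: "'a environment \<Rightarrow> 'a set" where
  "finite_sites E = {y \<in> sites E. open_cost E y < top}"

definition real_cost :: "'a environment \<Rightarrow> 'a \<Rightarrow> real" where
  "real_cost E y = enn2real (open_cost E y)"

definition client_dist :: "'a environment \<Rightarrow> 'a client list \<Rightarrow> nat \<Rightarrow> 'a \<Rightarrow> real" where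
  "client_dist E cs j y = metric E (position (cs ! j)) y"

definition free :: "'a environment \<Rightarrow> 'a client \<Rightarrow> bool" where
  "free E c \<longleftrightarrow> position c \<in> sites E \<and> open_cost E (position c) = 0"

definition paying :: "'a environment \<Rightarrow> 'a client list \<Rightarrow> nat set" where
  "paying E cs = {j. j < length cs \<and> \<not> free E (cs ! j)}"

text \<open>
  A free client is served at once at no cost. By contrast, any other client forces a positive lower bound on the
  optimum, even if the infimum of the costs of serving this client alone is 0: in that case
  an optimal solution must open a facility at the position of the client.
\<close>

definition optimum_bound :: "'a environment \<Rightarrow> 'a \<Rightarrow> real \<Rightarrow> bool" where
  "optimum_bound E x L \<longleftrightarrow> 0 < L \<and> (\<forall>cs S. client_sequence E cs \<longrightarrow>
     (\<exists>j < length cs. position (cs ! j) = x) \<longrightarrow> optimal E cs S \<longrightarrow> ennreal L \<le> total_cost E cs S)"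

text \<open>A function of the position and the index alone, so it is known on arrival and never
  revised. The powers of 1/2 keep the sum below a millionth of the optimum for sequences of any
  length.\<close>

definition slack :: "'a environment \<Rightarrow> 'a client list \<Rightarrow> nat \<Rightarrow> real" where
  "slack E cs j = (let x = position (cs ! j) in
     (if \<exists>L. optimum_bound E x L then SOME L. optimum_bound E x L else 1) * (1/2) ^ Suc j / 1000000)"

abbreviation served_clients ::
  "'a environment \<Rightarrow> 'a client list \<Rightarrow> nat set \<Rightarrow> (nat \<Rightarrow> real) \<Rightarrow> (nat \<Rightarrow> 'a facility) \<Rightarrow> bool" where
  "served_clients E cs P T F \<equiv> offers.served (finite_sites E) (real_cost E) (client_dist E cs)
     (\<lambda>j. arrival (cs ! j)) (slack E cs) (143/50) P {} T F"

type_synonym 'a plan = "nat \<Rightarrow> real \<times> 'a facility"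

definition sound_plan :: "'a environment \<Rightarrow> 'a client list \<Rightarrow> 'a plan \<Rightarrow> bool" where
  "sound_plan E cs q \<longleftrightarrow>
     (\<forall>j < length cs. free E (cs ! j) \<longrightarrow>
        q j = (arrival (cs ! j), position (cs ! j), arrival (cs ! j))) \<and>
     served_clients E cs (paying E cs) (\<lambda>j. fst (q j)) (\<lambda>j. snd (q j))"

definition same_before :: "real \<Rightarrow> nat \<Rightarrow> 'a plan \<Rightarrow> 'a plan \<Rightarrow> bool" where
  "same_before s n q q' \<longleftrightarrow> (\<forall>j < n. q' j = q j \<or> s \<le> fst (q j) \<and> s \<le> fst (q' j))"

text \<open>Plans are chosen along the prefixes, each relative to the one before, so that sequences
  with a common prefix share the plan for it. The list is reversed to recurse on the last
  client.\<close>

primrec plan_rev :: "'a environment \<Rightarrow> 'a client list \<Rightarrow> 'a plan" where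
  "plan_rev E [] = undefined"
| "plan_rev E (c # cs) = (SOME q. sound_plan E (rev (c # cs)) q \<and>
     same_before (arrival c) (length cs) (plan_rev E cs) q)"

definition plan :: "'a environment \<Rightarrow> 'a client list \<Rightarrow> 'a plan" where
  "plan E cs = plan_rev E (rev cs)"

text \<open>If all sites have infinite opening cost, any feasible schedule is as good as another.\<close>

definition direct :: "'a environment \<Rightarrow> 'a client list \<Rightarrow> 'a plan" where
  "direct E cs j = (arrival (cs ! j), SOME y. y \<in> sites E, arrival (cs ! j))"

definition schedule :: "'a environment \<Rightarrow> 'a client list \<Rightarrow> 'a plan" where
  "schedule E cs = (if finite_sites E = {} then direct E cs else plan E cs)"

definition algorithm :: "'a algorithm" where
  "algorithm E cs = \<lparr>opened = (\<lambda>j. snd (schedule E cs j)) ` {..<length cs},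
     conn_time = (\<lambda>j. fst (schedule E cs j)), conn_fac = (\<lambda>j. snd (schedule E cs j))\<rparr>"

lemma slack_pos: "0 < slack E cs j"
proof -
  have "0 < (SOME L. optimum_bound E x L)" if "\<exists>L. optimum_bound E x L" for x
    using someI_ex[OF that] by (simp add: optimum_bound_def)
  then show ?thesis by (simp add: slack_def Let_def)
qed

lemma offers_interpretation:
  assumes "environment E" "finite_sites E \<noteq> {}"
  shows "offers (finite_sites E) (real_cost E) (client_dist E cs) (slack E cs) (143/50)"
proof -
  interpret Metric_space "points E" "metric E" using assms by (simp add: environment_def)
  show ?thesis
    by unfold_locales (use assms in \<open>auto simp: real_cost_def client_dist_def slack_pos\<close>)
qed

section \<open>Extending a plan by one client\<close>

lemma client_sequence_snoc:
  "client_sequence E (cs @ [c]) \<longleftrightarrow>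
     client_sequence E cs \<and> (\<forall>b \<in> set cs. arrival b \<le> arrival c) \<and> position c \<in> points E"
  by (auto simp: client_sequence_def sorted_append)

lemma paying_snoc:
  "paying E (cs @ [c]) = (if free E c then paying E cs else insert (length cs) (paying E cs))"
  by (auto simp: paying_def nth_append less_Suc_eq)

lemma paying_finite: "finite (paying E cs)"
  by (simp add: paying_def)

lemma served_clients_snoc:
  assumes E: "environment E" "finite_sites E \<noteq> {}"
    and eq: "\<And>j. j \<in> paying E cs \<Longrightarrow> T' j = T j \<and> F' j = F j"
  shows "served_clients E (cs @ [c]) (paying E cs) T' F' \<longleftrightarrow> served_clients E cs (paying E cs) T F"
  by (rule served_cong[OF offers_interpretation[OF E] offers_interpretation[OF E]])
     (use eq in \<open>auto simp: paying_def client_dist_def slack_def nth_append\<close>)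

lemma extend_plan:
  assumes E: "environment E" "finite_sites E \<noteq> {}" and cs: "client_sequence E (cs @ [c])"
    and q: "sound_plan E cs q"
  shows "\<exists>q'. sound_plan E (cs @ [c]) q' \<and> same_before (arrival c) (length cs) q q'"
proof (cases "free E c")
  case True
  define q' where "q' = q(length cs := (arrival c, position c, arrival c))"
  have q'q: "q' j = q j" if "j < length cs" for j using that by (simp add: q'_def)
  have "served_clients E (cs @ [c]) (paying E cs) (\<lambda>j. fst (q' j)) (\<lambda>j. snd (q' j))"
    using q q'q by (subst served_clients_snoc[OF E]) (auto simp: sound_plan_def paying_def)
  then have "sound_plan E (cs @ [c]) q'"
    using q True by (auto simp: sound_plan_def paying_snoc q'_def nth_append less_Suc_eq)
  then show ?thesis using q'q by (auto simp: same_before_def)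
next
  case False
  let ?n = "length cs" and ?s = "arrival c"
  let ?T = "\<lambda>j. fst (q j)" and ?F = "\<lambda>j. snd (q j)"
  interpret offers "finite_sites E" "real_cost E" "client_dist E (cs @ [c])"
    "\<lambda>j. arrival ((cs @ [c]) ! j)" "slack E (cs @ [c])" "143/50"
    by (rule offers_interpretation[OF E])
  have P: "paying E (cs @ [c]) = insert ?n (paying E cs)" using False by (simp add: paying_snoc)
  define A where "A = insert ?n {j \<in> paying E cs. ?s \<le> ?T j}"
  have "served (paying E cs) {} ?T ?F"
    using q served_clients_snoc[OF E, of cs ?T ?T ?F ?F c] by (simp add: sound_plan_def)
  moreover have "arrival ((cs @ [c]) ! j) \<le> ?s" if "j \<in> paying E cs" for j
    using that cs by (auto simp: paying_def nth_append client_sequence_snoc)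
  ultimately have "served (insert ?n (paying E cs)) A ?T ?F \<and> active_at ?s (insert ?n (paying E cs)) A ?T ?F"
    unfolding A_def by (intro new_client) (auto simp: paying_finite paying_def)
  then obtain T' F' where *: "served (insert ?n (paying E cs)) {} T' F'"
    "\<forall>j \<in> insert ?n (paying E cs) - A. T' j = ?T j \<and> F' j = ?F j" "\<forall>j \<in> A. ?s \<le> T' j"
    using continuation[of "insert ?n (paying E cs)" A ?T ?F ?s] by (auto simp: paying_finite A_def)
  define q' where "q' = (\<lambda>j. if j \<in> insert ?n (paying E cs) then (T' j, F' j) else q j)"
  have "served (insert ?n (paying E cs)) {} (\<lambda>j. fst (q' j)) (\<lambda>j. snd (q' j)) \<longleftrightarrow>
      served (insert ?n (paying E cs)) {} T' F'"
    by (rule served_cong) (unfold_locales, auto simp: q'_def)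
  then have "sound_plan E (cs @ [c]) q'"
    using q *(1) False unfolding sound_plan_def P
    by (auto simp: q'_def nth_append less_Suc_eq paying_def)
  moreover have "same_before ?s ?n q q'"
    using *(2,3) by (auto simp: same_before_def q'_def A_def prod_eq_iff not_le)
  ultimately show ?thesis by blast
qed

lemma plan_snoc:
  "plan E (cs @ [c]) = (SOME q. sound_plan E (cs @ [c]) q \<and> same_before (arrival c) (length cs) (plan E cs) q)"
  by (simp add: plan_def)

lemma sound_plan_plan:
  assumes E: "environment E" "finite_sites E \<noteq> {}"
  shows "client_sequence E cs \<Longrightarrow> sound_plan E cs (plan E cs)"
proof (induction cs rule: rev_induct)
  case Nil
  show ?case
    by (simp add: sound_plan_def paying_def offers.served_def[OF offers_interpretation[OF E]])
next
  case (snoc c cs)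
  then have "\<exists>q. sound_plan E (cs @ [c]) q \<and> same_before (arrival c) (length cs) (plan E cs) q"
    by (intro extend_plan[OF E]) (auto simp: client_sequence_snoc)
  from someI_ex[OF this] show ?case by (simp add: plan_snoc)
qed

lemma same_before_plan:
  assumes E: "environment E" "finite_sites E \<noteq> {}" and cs: "client_sequence E (cs @ [c])"
  shows "same_before (arrival c) (length cs) (plan E cs) (plan E (cs @ [c]))"
proof -
  have "\<exists>q. sound_plan E (cs @ [c]) q \<and> same_before (arrival c) (length cs) (plan E cs) q"
    using cs by (intro extend_plan[OF E cs] sound_plan_plan[OF E]) (auto simp: client_sequence_snoc)
  from someI_ex[OF this] show ?thesis by (simp add: plan_snoc)
qed

lemma plan_facts:
  assumes E: "environment E" "finite_sites E \<noteq> {}" and cs: "client_sequence E cs" and j: "j < length cs"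
  shows "location (snd (plan E cs j)) \<in> sites E"
    "opening_time (snd (plan E cs j)) \<le> fst (plan E cs j)"
    "arrival (cs ! j) \<le> fst (plan E cs j)"
    "\<exists>i < length cs. snd (plan E cs i) = snd (plan E cs j) \<and>
      fst (plan E cs i) = opening_time (snd (plan E cs j))"
proof -
  let ?q = "plan E cs"
  have sound: "sound_plan E cs ?q" by (rule sound_plan_plan[OF E cs])
  have "location (snd (?q j)) \<in> sites E \<and> opening_time (snd (?q j)) \<le> fst (?q j) \<and>
    arrival (cs ! j) \<le> fst (?q j) \<and>
    (\<exists>i < length cs. snd (?q i) = snd (?q j) \<and> fst (?q i) = opening_time (snd (?q j)))"
  proof (cases "free E (cs ! j)")
    case True
    then show ?thesis using sound j by (auto simp: sound_plan_def free_def)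
  next
    case False
    then have P: "j \<in> paying E cs" using j by (simp add: paying_def)
    have "\<exists>i \<in> paying E cs. snd (?q i) = snd (?q j) \<and> fst (?q i) = opening_time (snd (?q j))"
      "location (snd (?q j)) \<in> finite_sites E" "opening_time (snd (?q j)) \<le> fst (?q j)"
      "arrival (cs ! j) \<le> fst (?q j)"
      using sound P unfolding sound_plan_def offers.served_def[OF offers_interpretation[OF E]] by auto
    then show ?thesis by (auto simp: finite_sites_def paying_def)
  qed
  then show "location (snd (?q j)) \<in> sites E" "opening_time (snd (?q j)) \<le> fst (?q j)"
    "arrival (cs ! j) \<le> fst (?q j)"
    "\<exists>i < length cs. snd (?q i) = snd (?q j) \<and> fst (?q i) = opening_time (snd (?q j))" by auto
qed

lemma schedule_facts:
  assumes E: "environment E" and cs: "client_sequence E cs" and j: "j < length cs"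
  shows "location (snd (schedule E cs j)) \<in> sites E"
    "opening_time (snd (schedule E cs j)) \<le> fst (schedule E cs j)"
    "arrival (cs ! j) \<le> fst (schedule E cs j)"
    "\<exists>i < length cs. snd (schedule E cs i) = snd (schedule E cs j) \<and>
      fst (schedule E cs i) = opening_time (snd (schedule E cs j))"
proof -
  have "(SOME y. y \<in> sites E) \<in> sites E" using E by (simp add: environment_def some_in_eq)
  then show "location (snd (schedule E cs j)) \<in> sites E"
    "opening_time (snd (schedule E cs j)) \<le> fst (schedule E cs j)"
    "arrival (cs ! j) \<le> fst (schedule E cs j)"
    "\<exists>i < length cs. snd (schedule E cs i) = snd (schedule E cs j) \<and>
      fst (schedule E cs i) = opening_time (snd (schedule E cs j))"
    using plan_facts[OF E _ cs j] j by (auto simp: schedule_def direct_def)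
qed

section \<open>Feasibility and non-anticipation\<close>

lemma feasible_algorithm:
  assumes "environment E" "client_sequence E cs"
  shows "feasible E cs (algorithm E cs)"
  using schedule_facts[OF assms] by (auto simp: feasible_def algorithm_def)

lemma schedule_snoc:
  assumes E: "environment E" and cs: "client_sequence E (cs @ [c])" and T: "T < arrival c"
    and j: "j < length cs"
  shows "schedule E (cs @ [c]) j = schedule E cs j \<or> T < fst (schedule E cs j) \<and> T < fst (schedule E (cs @ [c]) j)"
proof (cases "finite_sites E = {}")
  case True
  then show ?thesis using j by (simp add: schedule_def direct_def nth_append)
next
  case False
  then show ?thesis
    using same_before_plan[OF E False cs] j T by (auto simp: schedule_def same_before_def)
qed

lemma connections_snoc:
  assumes E: "environment E" and cs: "client_sequence E (cs @ [c])" and T: "T < arrival c"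
  shows "connections_until T (cs @ [c]) (algorithm E (cs @ [c])) = connections_until T cs (algorithm E cs)"
proof -
  have "T < fst (schedule E (cs @ [c]) (length cs))"
    using schedule_facts(3)[OF E cs, of "length cs"] T by simp
  then show ?thesis using schedule_snoc[OF E cs T]
    by (fastforce simp: connections_until_def algorithm_def less_Suc_eq)
qed

text \<open>Two sequences that agree up to \<open>T\<close> are both extensions of their common
  prefix by clients arriving after \<open>T\<close>; comparing each with the prefix compares them
  with each other.\<close>

lemma connections_append:
  assumes E: "environment E"
  shows "client_sequence E (cs @ ds) \<Longrightarrow> \<forall>c \<in> set ds. T < arrival c \<Longrightarrow>
    connections_until T (cs @ ds) (algorithm E (cs @ ds)) = connections_until T cs (algorithm E cs)"
proof (induction ds rule: rev_induct)
  case (snoc c ds)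
  then show ?case
    using connections_snoc[OF E, of "cs @ ds" c T] client_sequence_snoc[of E "cs @ ds" c] by simp
qed simp

lemma arrived_prefix:
  assumes "client_sequence E cs"
  obtains ds where "cs = arrived T cs @ ds" "\<forall>c \<in> set ds. T < arrival c"
proof -
  have "sorted (map arrival cs)" using assms by (simp add: client_sequence_def)
  then have "\<exists>ds. cs = arrived T cs @ ds \<and> (\<forall>c \<in> set ds. T < arrival c)"
  proof (induction cs)
    case (Cons c cs)
    then obtain ds where ds: "cs = arrived T cs @ ds" "\<forall>c \<in> set ds. T < arrival c" by auto
    show ?case
    proof (cases "arrival c \<le> T")
      case True
      then show ?thesis using ds by (intro exI[of _ ds]) (simp add: arrived_def)
    next
      case False
      then have "\<forall>b \<in> set (c # cs). T < arrival b" using Cons.prems by auto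
      moreover from this have "arrived T (c # cs) = []" by (auto simp: arrived_def filter_empty_conv)
      ultimately show ?thesis by (intro exI[of _ "c # cs"]) auto
    qed
  qed (simp add: arrived_def)
  then show ?thesis using that by blast
qed

text \<open>Some client connects to each facility at the moment of its opening, so the connections
  made up to \<open>T\<close> determine the openings up to \<open>T\<close>.\<close>

lemma openings_eq:
  assumes "environment E" "client_sequence E cs"
  shows "openings_until T (algorithm E cs) =
    {f. opening_time f \<le> T \<and> (\<exists>j. (j, opening_time f, f) \<in> connections_until T cs (algorithm E cs))}"
proof (intro set_eqI iffI)
  fix f assume "f \<in> openings_until T (algorithm E cs)"
  then obtain j where j: "j < length cs" "f = snd (schedule E cs j)" "opening_time f \<le> T"
    by (auto simp: openings_until_def algorithm_def)
  then obtain i where "i < length cs" "snd (schedule E cs i) = f" "fst (schedule E cs i) = opening_time f"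
    using schedule_facts(4)[OF assms j(1)] by auto
  then show "f \<in> {f. opening_time f \<le> T \<and>
      (\<exists>j. (j, opening_time f, f) \<in> connections_until T cs (algorithm E cs))}"
    using j(3) by (auto simp: connections_until_def algorithm_def prod_eq_iff intro!: exI[of _ i])
next
  fix f assume "f \<in> {f. opening_time f \<le> T \<and>
      (\<exists>j. (j, opening_time f, f) \<in> connections_until T cs (algorithm E cs))}"
  then obtain j where "j < length cs" "schedule E cs j = (opening_time f, f)" "opening_time f \<le> T"
    by (fastforce simp: connections_until_def algorithm_def)
  then have "snd (schedule E cs j) = f" "j < length cs" "opening_time f \<le> T" by simp_all
  then show "f \<in> openings_until T (algorithm E cs)"
    by (auto simp: openings_until_def algorithm_def)
qed

lemma online_algorithm_algorithm: "online_algorithm algorithm"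
  unfolding online_algorithm_def
proof (intro allI impI conjI)
  fix E :: "'a environment" and cs assume "environment E" "client_sequence E cs"
  then show "feasible E cs (algorithm E cs)" by (rule feasible_algorithm)
next
  fix E :: "'a environment" and cs cs' T
  assume E: "environment E" and cs: "client_sequence E cs" and cs': "client_sequence E cs'"
    and eq: "arrived T cs = arrived T cs'"
  obtain ds where ds: "cs = arrived T cs @ ds" "\<forall>c \<in> set ds. T < arrival c"
    by (rule arrived_prefix[OF cs])
  obtain ds' where ds': "cs' = arrived T cs' @ ds'" "\<forall>c \<in> set ds'. T < arrival c"
    by (rule arrived_prefix[OF cs'])
  show conns: "connections_until T cs (algorithm E cs) = connections_until T cs' (algorithm E cs')"
    using connections_append[OF E, of "arrived T cs" ds T] connections_append[OF E, of "arrived T cs'" ds' T]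
      ds ds' cs cs' eq by metis
  show "openings_until T (algorithm E cs) = openings_until T (algorithm E cs')"
    unfolding openings_eq[OF E cs] openings_eq[OF E cs'] conns ..
qed

section \<open>Competitiveness\<close>

lemma client_cost_nonneg:
  assumes "environment E" "feasible E cs S" "j < length cs"
  shows "metric E (position (cs ! j)) (location (conn_fac S j)) \<le> client_cost E cs S j"
    "0 \<le> client_cost E cs S j"
proof -
  interpret Metric_space "points E" "metric E" using assms by (simp add: environment_def)
  have "arrival (cs ! j) \<le> conn_time S j" "opening_time (conn_fac S j) \<le> conn_time S j"
    using assms by (auto simp: feasible_def)
  moreover have "0 \<le> metric E (position (cs ! j)) (location (conn_fac S j))" by simp
  ultimately show "metric E (position (cs ! j)) (location (conn_fac S j)) \<le> client_cost E cs S j"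
    "0 \<le> client_cost E cs S j"
    unfolding client_cost_def by linarith+
qed

lemma total_cost_ge:
  assumes "feasible E cs S" "j < length cs"
  shows "open_cost E (location (conn_fac S j)) + ennreal (client_cost E cs S j) \<le> total_cost E cs S"
  unfolding total_cost_def
proof (rule add_mono)
  show "open_cost E (location (conn_fac S j)) \<le> (\<Sum>f \<in> opened S. open_cost E (location f))"
    using assms member_le_sum[of "conn_fac S j" "opened S" "\<lambda>f. open_cost E (location f)"]
    by (auto simp: feasible_def)
  show "ennreal (client_cost E cs S j) \<le> (\<Sum>j < length cs. ennreal (client_cost E cs S j))"
    using assms by (intro member_le_sum) auto
qed

text \<open>An exchange argument: a client connected at a positive distance could instead open a
  site, on arrival, whose opening cost and distance together are below that distance. Finite total
  cost makes the improvement strict.\<close>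

lemma optimal_at_client:
  assumes E: "environment E" and cs: "client_sequence E cs" and opt: "optimal E cs S"
    and fin: "total_cost E cs S < top" and j: "j < length cs" and x: "position (cs ! j) = x"
    and cheap: "\<And>\<delta>. 0 < \<delta> \<Longrightarrow> \<exists>y \<in> sites E. open_cost E y + ennreal (metric E x y) < ennreal \<delta>"
  shows "location (conn_fac S j) = x"
proof (rule ccontr)
  assume neq: "location (conn_fac S j) \<noteq> x"
  interpret Metric_space "points E" "metric E" using E by (simp add: environment_def)
  have S: "feasible E cs S" using opt by (simp add: optimal_def)
  have "x \<in> points E" using cs j x by (auto simp: client_sequence_def)
  moreover have "location (conn_fac S j) \<in> points E"
    using S j E by (auto simp: feasible_def environment_def)
  ultimately have "0 < metric E x (location (conn_fac S j))" using neq by (metis mdist_pos_less)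
  then obtain y where y: "y \<in> sites E"
    "open_cost E y + ennreal (metric E x y) < ennreal (metric E x (location (conn_fac S j)))"
    using cheap by blast
  have cost_j: "ennreal (metric E x (location (conn_fac S j))) \<le> ennreal (client_cost E cs S j)"
    using client_cost_nonneg[OF E S j] x by (intro ennreal_leI) simp
  define f where "f = (y, arrival (cs ! j))"
  define S' where "S' = \<lparr>opened = insert f (opened S),
    conn_time = (conn_time S)(j := arrival (cs ! j)), conn_fac = (conn_fac S)(j := f)\<rparr>"
  have "feasible E cs S'" using S y by (auto simp: feasible_def S'_def f_def)
  then have le: "total_cost E cs S \<le> total_cost E cs S'" using opt by (simp add: optimal_def)
  define R where "R = (\<Sum>f \<in> opened S. open_cost E (location f))
    + (\<Sum>i \<in> {..<length cs} - {j}. ennreal (client_cost E cs S i))"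
  have tS: "total_cost E cs S = R + ennreal (client_cost E cs S j)"
    using j by (simp add: total_cost_def R_def sum.remove[of "{..<length cs}" j] ac_simps)
  have "(\<Sum>f \<in> insert f (opened S). open_cost E (location f))
      \<le> open_cost E y + (\<Sum>f \<in> opened S. open_cost E (location f))"
    using S by (cases "f \<in> opened S") (auto simp: insert_absorb feasible_def f_def)
  moreover have "(\<Sum>i < length cs. ennreal (client_cost E cs S' i))
      = ennreal (metric E x y) + (\<Sum>i \<in> {..<length cs} - {j}. ennreal (client_cost E cs S i))"
    using j x by (subst sum.remove[of _ j]) (auto simp: client_cost_def S'_def f_def intro!: sum.cong)
  ultimately have "total_cost E cs S' \<le> R + (open_cost E y + ennreal (metric E x y))"
    by (simp add: total_cost_def S'_def R_def add_mono ac_simps)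
  also have "\<dots> < R + ennreal (metric E x (location (conn_fac S j)))"
    using y fin tS by (auto simp: ennreal_add_left_cancel_less less_top)
  also have "\<dots> \<le> total_cost E cs S" unfolding tS using cost_j by (rule add_left_mono)
  finally show False using le by simp
qed

lemma optimum_bound_exists:
  assumes E: "environment E" and x: "\<not> (x \<in> sites E \<and> open_cost E x = 0)"
  shows "\<exists>L. optimum_bound E x L"
proof (cases "\<exists>\<delta>>0. \<forall>y \<in> sites E. ennreal \<delta> \<le> open_cost E y + ennreal (metric E x y)")
  case True
  then obtain \<delta> where \<delta>: "0 < \<delta>" "\<And>y. y \<in> sites E \<Longrightarrow> ennreal \<delta> \<le> open_cost E y + ennreal (metric E x y)"
    by blast
  have "ennreal \<delta> \<le> total_cost E cs S"
    if "optimal E cs S" "j < length cs" "position (cs ! j) = x" for cs S j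
  proof -
    have S: "feasible E cs S" using that by (simp add: optimal_def)
    then have "location (conn_fac S j) \<in> sites E" using that by (auto simp: feasible_def)
    then have "ennreal \<delta> \<le> open_cost E (location (conn_fac S j)) + ennreal (metric E x (location (conn_fac S j)))"
      by (rule \<delta>)
    also have "\<dots> \<le> open_cost E (location (conn_fac S j)) + ennreal (client_cost E cs S j)"
      using client_cost_nonneg[OF E S that(2)] that by (intro add_left_mono ennreal_leI) simp
    also have "\<dots> \<le> total_cost E cs S" by (rule total_cost_ge[OF S that(2)])
    finally show ?thesis .
  qed
  then show ?thesis using \<delta>(1) by (auto simp: optimum_bound_def)
next
  case False
  then have cheap: "\<exists>y \<in> sites E. open_cost E y + ennreal (metric E x y) < ennreal \<delta>" if "0 < \<delta>" for \<delta>
    using that by (auto simp: not_le)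
  \<comment> \<open>An optimum of finite cost opens a facility at \<open>x\<close> and pays
    \<open>open_cost E x\<close>. If \<open>x\<close> is not a site of finite cost, the optimum is
    infinite and any positive bound will do.\<close>
  define L where "L = (if x \<in> sites E \<and> open_cost E x < top then enn2real (open_cost E x) else 1)"
  have "0 < L" using x by (auto simp: L_def enn2real_positive_iff zero_less_iff_neq_zero)
  moreover have "ennreal L \<le> total_cost E cs S"
    if cs: "client_sequence E cs" and opt: "optimal E cs S" and j: "j < length cs" "position (cs ! j) = x" for cs S j
  proof (cases "total_cost E cs S < top")
    case True
    have S: "feasible E cs S" using opt by (simp add: optimal_def)
    have loc: "location (conn_fac S j) = x" by (rule optimal_at_client[OF E cs opt True j cheap])
    then have "x \<in> sites E" using S j by (auto simp: feasible_def)
    moreover have le: "open_cost E x \<le> total_cost E cs S"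
      using total_cost_ge[OF S j(1)] loc by (meson add_increasing2 order_trans order_refl zero_le)
    moreover have "open_cost E x < top" using le True by (rule le_less_trans)
    ultimately show ?thesis by (simp add: L_def less_top)
  qed (simp add: not_less top_unique)
  ultimately show ?thesis by (auto simp: optimum_bound_def)
qed

lemma sum_slack_le:
  assumes E: "environment E" and cs: "client_sequence E cs" and opt: "optimal E cs S"
    and C: "total_cost E cs S = ennreal C" "0 \<le> C"
  shows "(\<Sum>j \<in> paying E cs. slack E cs j) \<le> C / 1000000"
proof -
  have "slack E cs j \<le> C / 1000000 * (1/2) ^ Suc j" if j: "j \<in> paying E cs" for j
  proof -
    define x where "x = position (cs ! j)"
    have jl: "j < length cs" using j by (simp add: paying_def)
    have ex: "\<exists>L. optimum_bound E x L"
      using j by (intro optimum_bound_exists[OF E]) (auto simp: paying_def free_def x_def)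
    define L where "L = (SOME L. optimum_bound E x L)"
    have "optimum_bound E x L" unfolding L_def by (rule someI_ex[OF ex])
    then have "ennreal L \<le> total_cost E cs S"
      using cs opt jl unfolding optimum_bound_def x_def by blast
    then have "L \<le> C" using C by (simp add: ennreal_le_iff)
    then have "L * ((1/2) ^ Suc j / 1000000) \<le> C * ((1/2) ^ Suc j / 1000000)"
      by (intro mult_right_mono) auto
    then show ?thesis using ex by (simp add: slack_def x_def[symmetric] L_def[symmetric])
  qed
  then have "(\<Sum>j \<in> paying E cs. slack E cs j) \<le> (\<Sum>j \<in> paying E cs. C / 1000000 * (1/2) ^ Suc j)"
    by (intro sum_mono)
  also have "\<dots> \<le> (\<Sum>j < length cs. C / 1000000 * (1/2) ^ Suc j)"
    using C by (intro sum_mono2) (auto simp: paying_def)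
  also have "\<dots> = C / 1000000 * (\<Sum>j < length cs. (1/2) ^ Suc j)" by (simp add: sum_distrib_left)
  also have "(\<Sum>j < n. (1/2::real) ^ Suc j) = 1 - (1/2) ^ n" for n
    by (induction n) auto
  also have "C / 1000000 * (1 - (1/2) ^ length cs) \<le> C / 1000000 * 1"
    using C by (intro mult_left_mono) auto
  finally show ?thesis by simp
qed

lemma algorithm_cost_le:
  assumes E: "environment E" and Y: "finite_sites E \<noteq> {}" and cs: "client_sequence E cs"
  shows "total_cost E cs (algorithm E cs)
    \<le> ennreal (\<Sum>j \<in> paying E cs. 193/50 * (fst (plan E cs j) - arrival (cs ! j)) + slack E cs j)"
proof -
  interpret Metric_space "points E" "metric E" using E by (simp add: environment_def)
  define P where "P = paying E cs"
  define T where "T = (\<lambda>j. fst (plan E cs j))"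
  define F where "F = (\<lambda>j. snd (plan E cs j))"
  define A where "A = algorithm E cs"
  have sound: "sound_plan E cs (plan E cs)" by (rule sound_plan_plan[OF E Y cs])
  have free: "F j = (position (cs ! j), arrival (cs ! j))" "T j = arrival (cs ! j)"
    "open_cost E (position (cs ! j)) = 0" if "j \<in> {..<length cs} - P" for j
    using sound that by (auto simp: sound_plan_def P_def paying_def F_def T_def free_def)
  have "served_clients E cs P T F"
    using sound unfolding sound_plan_def P_def T_def F_def by blast
  note served_all = this[unfolded offers.served_def[OF offers_interpretation[OF E Y]] client_dist_def
      Diff_empty empty_iff HOL.simp_thms]
  have served: "location (F j) \<in> finite_sites E" "opening_time (F j) \<le> T j"
    "metric E (position (cs ! j)) (location (F j)) + (T j - opening_time (F j))
      \<le> 143/50 * (T j - arrival (cs ! j)) + slack E cs j"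
    "real_cost E (location (F j)) + (\<Sum>i | i \<in> P \<and> F i = F j \<and> T i = opening_time (F j).
        metric E (position (cs ! i)) (location (F j)) - 143/50 * (T i - arrival (cs ! i)) - slack E cs i) \<le> 0"
    if "j \<in> P" for j
    using served_all[rule_format, OF that] by simp_all
  have A: "opened A = F ` {..<length cs}" "conn_time A = T" "conn_fac A = F"
    using Y by (simp_all add: A_def algorithm_def schedule_def T_def F_def)
  have P: "finite P" "P \<subseteq> {..<length cs}" by (auto simp: P_def paying_def)
  have "(\<Sum>f \<in> opened A. open_cost E (location f)) = (\<Sum>f \<in> F ` P. open_cost E (location f))"
    unfolding A
  proof (rule sum.mono_neutral_right)
    show "\<forall>f \<in> F ` {..<length cs} - F ` P. open_cost E (location f) = 0"
    proof
      fix f assume "f \<in> F ` {..<length cs} - F ` P"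
      then obtain j where "j \<in> {..<length cs} - P" "f = F j" by blast
      then show "open_cost E (location f) = 0" using free[of j] by simp
    qed
  qed (use P in auto)
  also have "\<dots> = (\<Sum>f \<in> F ` P. ennreal (real_cost E (location f)))"
    using served(1) by (intro sum.cong) (auto simp: real_cost_def finite_sites_def less_top)
  also have "\<dots> = ennreal (\<Sum>f \<in> F ` P. real_cost E (location f))"
    by (intro sum_ennreal) (simp add: real_cost_def)
  finally have open_eq: "(\<Sum>f \<in> opened A. open_cost E (location f)) = ennreal (\<Sum>f \<in> F ` P. real_cost E (location f))" .
  have "(\<Sum>j < length cs. ennreal (client_cost E cs A j)) = (\<Sum>j \<in> P. ennreal (client_cost E cs A j))"
  proof (rule sum.mono_neutral_right)
    show "\<forall>j \<in> {..<length cs} - P. ennreal (client_cost E cs A j) = 0"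
    proof
      fix j assume j: "j \<in> {..<length cs} - P"
      then have "position (cs ! j) \<in> points E" using cs by (auto simp: client_sequence_def)
      then show "ennreal (client_cost E cs A j) = 0" by (simp add: client_cost_def A free[OF j])
    qed
  qed (use P in auto)
  also have "\<dots> = ennreal (\<Sum>j \<in> P. client_cost E cs A j)"
    using client_cost_nonneg(2)[OF E feasible_algorithm[OF E cs]] P
    by (intro sum_ennreal) (auto simp: A_def)
  finally have clients_eq: "(\<Sum>j < length cs. ennreal (client_cost E cs A j)) = ennreal (\<Sum>j \<in> P. client_cost E cs A j)" .
  \<comment> \<open>\<open>- v j\<close> is what client \<open>j\<close> has left after its
    connection, its own waiting aside. Those connected at the opening cover the cost of the facility
    and later clients have a nonnegative rest. The own waiting turns \<open>p\<close> = 143/50 into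
    193/50.\<close>
  define v where "v = (\<lambda>j. metric E (position (cs ! j)) (location (F j)) + (T j - opening_time (F j))
    - 143/50 * (T j - arrival (cs ! j)) - slack E cs j)"
  have "(\<Sum>j \<in> P. v j) = (\<Sum>f \<in> F ` P. \<Sum>j | j \<in> P \<and> F j = f. v j)"
    by (rule sum.image_gen[OF P(1)])
  also have "\<dots> \<le> (\<Sum>f \<in> F ` P. - real_cost E (location f))"
  proof (rule sum_mono)
    fix f assume "f \<in> F ` P"
    then obtain k where k: "k \<in> P" "f = F k" by auto
    have "(\<Sum>j | j \<in> P \<and> F j = f. v j) \<le> (\<Sum>j | j \<in> P \<and> F j = f \<and> T j = opening_time f. v j)"
    proof -
      have "(\<Sum>j | j \<in> P \<and> F j = f. - v j) \<ge> (\<Sum>j | j \<in> P \<and> F j = f \<and> T j = opening_time f. - v j)"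
      proof (rule sum_mono2)
        show "0 \<le> - v j" if "j \<in> {j. j \<in> P \<and> F j = f} - {j. j \<in> P \<and> F j = f \<and> T j = opening_time f}" for j
          using served(3)[of j] that unfolding v_def by simp
      qed (use P in auto)
      then show ?thesis by (simp add: sum_negf)
    qed
    also have "\<dots> = (\<Sum>i | i \<in> P \<and> F i = F k \<and> T i = opening_time (F k).
        metric E (position (cs ! i)) (location (F k)) - 143/50 * (T i - arrival (cs ! i)) - slack E cs i)"
      unfolding k(2) by (intro sum.cong) (auto simp: v_def)
    also have "\<dots> \<le> - real_cost E (location f)" using served(4)[OF k(1)] k(2) by simp
    finally show "(\<Sum>j | j \<in> P \<and> F j = f. v j) \<le> - real_cost E (location f)" .
  qed
  finally have "(\<Sum>f \<in> F ` P. real_cost E (location f)) + (\<Sum>j \<in> P. v j) \<le> 0"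
    by (simp add: sum_negf)
  moreover have "(\<Sum>j \<in> P. client_cost E cs A j)
      = (\<Sum>j \<in> P. v j + (193/50 * (T j - arrival (cs ! j)) + slack E cs j))"
    by (intro sum.cong) (auto simp: client_cost_def A v_def field_simps)
  ultimately have "(\<Sum>f \<in> F ` P. real_cost E (location f)) + (\<Sum>j \<in> P. client_cost E cs A j)
      \<le> (\<Sum>j \<in> P. 193/50 * (T j - arrival (cs ! j)) + slack E cs j)"
    by (simp add: sum.distrib)
  then have "total_cost E cs A \<le> ennreal (\<Sum>j \<in> P. 193/50 * (T j - arrival (cs ! j)) + slack E cs j)"
    unfolding total_cost_def open_eq clients_eq
    using client_cost_nonneg(2)[OF E feasible_algorithm[OF E cs]] P
    by (subst ennreal_plus[symmetric])
       (auto intro!: sum_nonneg ennreal_leI simp: real_cost_def A_def)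
  then show ?thesis by (simp add: A_def P_def T_def)
qed

text \<open>All times are shifted by \<tau>, later the opening time of the facility in the optimum.
  The slack is counted as part of the distance, so the error of the connection of \<open>i\<close>
  is absorbed in the inequality between \<open>i\<close> and \<open>j\<close>.\<close>

lemma optimal_star_bound:
  assumes E: "environment E" and Y: "finite_sites E \<noteq> {}" and cs: "client_sequence E cs"
    and y: "y \<in> finite_sites E" and G: "G \<subseteq> paying E cs"
  shows "193/50 * (\<Sum>j \<in> G. fst (plan E cs j) - arrival (cs ! j))
    \<le> 2418/625 * (real_cost E y + (\<Sum>j \<in> G. metric E (position (cs ! j)) y + slack E cs j + \<bar>arrival (cs ! j) - \<tau>\<bar>))"
proof -
  interpret Metric_space "points E" "metric E" using E by (simp add: environment_def)
  define P where "P = paying E cs"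
  define T where "T = (\<lambda>j. fst (plan E cs j))"
  define F where "F = (\<lambda>j. snd (plan E cs j))"
  have sound: "sound_plan E cs (plan E cs)" by (rule sound_plan_plan[OF E Y cs])
  have "served_clients E cs P T F"
    using sound unfolding sound_plan_def P_def T_def F_def by blast
  note served_all = this[unfolded offers.served_def[OF offers_interpretation[OF E Y]]
      offers.offer_def[OF offers_interpretation[OF E Y]] client_dist_def
      Diff_empty empty_iff HOL.simp_thms]
  have served: "arrival (cs ! j) \<le> T j" "location (F j) \<in> finite_sites E" "opening_time (F j) \<le> T j"
    "metric E (position (cs ! j)) (location (F j)) + (T j - opening_time (F j))
      \<le> 143/50 * (T j - arrival (cs ! j)) + slack E cs j"
    "\<And>i. i \<in> P \<Longrightarrow> opening_time (F i) < T j \<Longrightarrow> 143/50 * (T j - arrival (cs ! j))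
      \<le> metric E (position (cs ! j)) (location (F i)) + (T j - opening_time (F i))"
    "\<And>y. y \<in> finite_sites E \<Longrightarrow> (\<Sum>i | i \<in> P \<and> T j \<le> T i.
       max 0 (143/50 * (T j - arrival (cs ! i)) - metric E (position (cs ! i)) y)) \<le> real_cost E y"
    if "j \<in> P" for j
    using served_all[rule_format, OF that] by simp_all
  have points: "position (cs ! j) \<in> points E" if "j \<in> P" for j
    using cs that by (auto simp: client_sequence_def P_def paying_def)
  have sites: "y \<in> points E" if "y \<in> finite_sites E" for y
    using E that by (auto simp: environment_def finite_sites_def)
  have G: "G \<subseteq> P" "finite G" "finite P" using G finite_subset[OF G] by (auto simp: P_def paying_finite)
  have "193/50 * (\<Sum>j \<in> G. (T j - \<tau>) - (arrival (cs ! j) - \<tau>))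
    \<le> 2418/625 * (real_cost E y + (\<Sum>j \<in> G. (metric E (position (cs ! j)) y + slack E cs j) + \<bar>arrival (cs ! j) - \<tau>\<bar>))"
  proof (rule star_bound[OF G(2)])
    fix i assume i: "i \<in> G"
    then have iP: "i \<in> P" using G by auto
    show "arrival (cs ! i) - \<tau> \<le> T i - \<tau>" using served(1)[OF iP] by simp
    show "0 \<le> metric E (position (cs ! i)) y + slack E cs i"
      using slack_pos[of E cs i] by (simp add: less_imp_le)
    have "(\<Sum>j | j \<in> G \<and> T i - \<tau> \<le> T j - \<tau>. max 0 (143/50 * (T i - \<tau> - (arrival (cs ! j) - \<tau>))
         - (metric E (position (cs ! j)) y + slack E cs j)))
      \<le> (\<Sum>j | j \<in> G \<and> T i \<le> T j. max 0 (143/50 * (T i - arrival (cs ! j)) - metric E (position (cs ! j)) y))"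
    proof -
      have "143/50 * (T i - \<tau> - (arrival (cs ! j) - \<tau>)) - (metric E (position (cs ! j)) y + slack E cs j)
        \<le> 143/50 * (T i - arrival (cs ! j)) - metric E (position (cs ! j)) y" for j
      proof -
        have "T i - \<tau> - (arrival (cs ! j) - \<tau>) = T i - arrival (cs ! j)" by simp
        then show ?thesis using slack_pos[of E cs j] by simp
      qed
      then show ?thesis by (auto intro!: sum_mono max.mono)
    qed
    also have "\<dots> \<le> (\<Sum>j | j \<in> P \<and> T i \<le> T j. max 0 (143/50 * (T i - arrival (cs ! j)) - metric E (position (cs ! j)) y))"
      using G by (intro sum_mono2) auto
    also have "\<dots> \<le> real_cost E y" by (rule served(6)[OF iP y])
    finally show "(\<Sum>j | j \<in> G \<and> T i - \<tau> \<le> T j - \<tau>. max 0 (143/50 * (T i - \<tau> - (arrival (cs ! j) - \<tau>))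
         - (metric E (position (cs ! j)) y + slack E cs j))) \<le> real_cost E y" .
  next
    fix i j assume "i \<in> G" "j \<in> G" and lt: "T i - \<tau> < T j - \<tau>"
    then have iP: "i \<in> P" and jP: "j \<in> P" using G by auto
    let ?x = "\<lambda>j. position (cs ! j)" and ?z = "location (F i)"
    have z: "?z \<in> points E" by (rule sites[OF served(2)[OF iP]])
    have "metric E (?x j) ?z \<le> metric E (?x j) y + metric E y ?z"
      by (rule triangle[OF points[OF jP] sites[OF y] z])
    also have "metric E y ?z \<le> metric E y (?x i) + metric E (?x i) ?z"
      by (rule triangle[OF sites[OF y] points[OF iP] z])
    also have "metric E y (?x i) = metric E (?x i) y" by (rule commute)
    finally have "metric E (?x j) ?z \<le> metric E (?x j) y + (metric E (?x i) y + metric E (?x i) ?z)"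
      by simp
    then show "(143/50 - 1) * (T j - \<tau> - (T i - \<tau>))
      \<le> metric E (?x i) y + slack E cs i + (metric E (?x j) y + slack E cs j)
        + 143/50 * (arrival (cs ! j) - \<tau> - (arrival (cs ! i) - \<tau>))"
      using served(4)[OF iP] served(5)[OF jP iP] served(3)[OF iP] lt slack_pos[of E cs j]
      by (simp add: field_simps)
  qed (simp add: real_cost_def)
  then show ?thesis by (simp add: T_def)
qed

lemma competitive_algorithm: "competitive 3.869 algorithm"
  unfolding competitive_def
proof (intro allI impI)
  fix E :: "'a environment" and cs S
  assume E: "environment E" and cs: "client_sequence E cs" and opt: "optimal E cs S"
  have S: "feasible E cs S" using opt by (simp add: optimal_def)
  show "total_cost E cs (algorithm E cs) \<le> ennreal 3.869 * total_cost E cs S"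
  proof (cases "total_cost E cs S = top \<or> cs = []")
    case True
    then show ?thesis
      by (auto simp: total_cost_def algorithm_def ennreal_mult_top)
  next
    case False
    have fin_open: "location f \<in> finite_sites E" if "f \<in> opened S" for f
    proof -
      have "open_cost E (location f) \<le> (\<Sum>f \<in> opened S. open_cost E (location f))"
        using that S by (intro member_le_sum) (auto simp: feasible_def)
      also have "\<dots> \<le> total_cost E cs S" by (simp add: total_cost_def)
      finally show ?thesis
        using False that S by (auto simp: finite_sites_def feasible_def less_top top_unique)
    qed
    have "conn_fac S 0 \<in> opened S" using S False by (auto simp: feasible_def)
    then have Y: "finite_sites E \<noteq> {}" using fin_open by blast
    define C where "C = (\<Sum>f \<in> opened S. real_cost E (location f)) + (\<Sum>j < length cs. client_cost E cs S j)"
    have C0: "0 \<le> (\<Sum>f \<in> opened S. real_cost E (location f))" "0 \<le> (\<Sum>j < length cs. client_cost E cs S j)"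
      using client_cost_nonneg(2)[OF E S] by (auto intro!: sum_nonneg simp: real_cost_def)
    have C: "total_cost E cs S = ennreal C"
    proof -
      have "(\<Sum>f \<in> opened S. open_cost E (location f)) = (\<Sum>f \<in> opened S. ennreal (real_cost E (location f)))"
        using fin_open by (intro sum.cong) (auto simp: real_cost_def finite_sites_def less_top)
      also have "\<dots> = ennreal (\<Sum>f \<in> opened S. real_cost E (location f))"
        by (intro sum_ennreal) (simp add: real_cost_def)
      moreover have "(\<Sum>j < length cs. ennreal (client_cost E cs S j)) = ennreal (\<Sum>j < length cs. client_cost E cs S j)"
        using client_cost_nonneg(2)[OF E S] by (intro sum_ennreal) auto
      ultimately show ?thesis using C0 by (simp add: total_cost_def C_def)
    qed
    define P where "P = paying E cs"
    have P: "finite P" "P \<subseteq> {..<length cs}" by (auto simp: P_def paying_def)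
    define w where "w = (\<lambda>j. fst (plan E cs j) - arrival (cs ! j))"
    have "193/50 * (\<Sum>j \<in> P. w j) = (\<Sum>f \<in> opened S. 193/50 * (\<Sum>j | j \<in> P \<and> conn_fac S j = f. w j))"
    proof -
      have "conn_fac S ` P \<subseteq> opened S" using S P by (auto simp: feasible_def)
      then have "(\<Sum>f \<in> opened S. \<Sum>j | j \<in> P \<and> conn_fac S j = f. w j) = (\<Sum>j \<in> P. w j)"
        using S P by (intro sum.group) (auto simp: feasible_def)
      then show ?thesis unfolding sum_distrib_left[symmetric] by simp
    qed
    also have "\<dots> \<le> (\<Sum>f \<in> opened S. 2418/625 * (real_cost E (location f) +
        (\<Sum>j | j \<in> P \<and> conn_fac S j = f. client_cost E cs S j + slack E cs j)))"
    proof (rule sum_mono)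
      fix f assume f: "f \<in> opened S"
      have "193/50 * (\<Sum>j | j \<in> P \<and> conn_fac S j = f. w j) \<le> 2418/625 * (real_cost E (location f) +
        (\<Sum>j | j \<in> P \<and> conn_fac S j = f. metric E (position (cs ! j)) (location f) + slack E cs j
          + \<bar>arrival (cs ! j) - opening_time f\<bar>))"
        unfolding w_def by (rule optimal_star_bound[OF E Y cs fin_open[OF f]]) (auto simp: P_def)
      \<comment> \<open>The optimum connects at a time no earlier than the arrival and the opening,
        so its two waiting costs sum to at least the distance between these times.\<close>
      also have "\<dots> \<le> 2418/625 * (real_cost E (location f) +
        (\<Sum>j | j \<in> P \<and> conn_fac S j = f. client_cost E cs S j + slack E cs j))"
        using S P by (intro mult_left_mono add_left_mono sum_mono)
          (auto simp: client_cost_def feasible_def abs_le_iff subset_iff)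
      finally show "193/50 * (\<Sum>j | j \<in> P \<and> conn_fac S j = f. w j) \<le> 2418/625 * (real_cost E (location f) +
        (\<Sum>j | j \<in> P \<and> conn_fac S j = f. client_cost E cs S j + slack E cs j))" .
    qed
    also have "\<dots> = 2418/625 * ((\<Sum>f \<in> opened S. real_cost E (location f)) +
        (\<Sum>f \<in> opened S. \<Sum>j | j \<in> P \<and> conn_fac S j = f. client_cost E cs S j + slack E cs j))"
      unfolding sum_distrib_left[symmetric] by (simp only: sum.distrib)
    also have "(\<Sum>f \<in> opened S. \<Sum>j | j \<in> P \<and> conn_fac S j = f. client_cost E cs S j + slack E cs j)
        = (\<Sum>j \<in> P. client_cost E cs S j + slack E cs j)"
      using S P by (intro sum.group) (auto simp: feasible_def)
    also have "\<dots> \<le> (\<Sum>j < length cs. client_cost E cs S j) + C / 1000000"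
    proof -
      have "(\<Sum>j \<in> P. client_cost E cs S j) \<le> (\<Sum>j < length cs. client_cost E cs S j)"
        using P client_cost_nonneg(2)[OF E S] by (intro sum_mono2) auto
      moreover have "(\<Sum>j \<in> P. slack E cs j) \<le> C / 1000000"
        unfolding P_def by (rule sum_slack_le[OF E cs opt C]) (use C0 in \<open>simp add: C_def\<close>)
      ultimately show ?thesis unfolding sum.distrib by (rule add_mono)
    qed
    finally have w: "193/50 * (\<Sum>j \<in> P. w j) \<le> 2418/625 * (C + C / 1000000)"
      by (simp add: C_def algebra_simps)
    have "total_cost E cs (algorithm E cs) \<le> ennreal (\<Sum>j \<in> P. 193/50 * w j + slack E cs j)"
      unfolding P_def w_def by (rule algorithm_cost_le[OF E Y cs])
    also have "\<dots> \<le> ennreal (3.869 * C)"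
    proof (rule ennreal_leI)
      \<comment> \<open>The gap between 3.8688 and 3.869 absorbs both uses of the slack: 3.8688 * (1
        + 10^-6) + 10^-6 < 3.869.\<close>
      have "0 \<le> C" using C0 by (simp add: C_def)
      then show "(\<Sum>j \<in> P. 193/50 * w j + slack E cs j) \<le> 3.869 * C"
        unfolding sum.distrib sum_distrib_left[symmetric] using w sum_slack_le[OF E cs opt C]
        by (simp add: P_def)
    qed
    also have "\<dots> = ennreal 3.869 * total_cost E cs S"
      unfolding C by (rule ennreal_mult) (use C0 in \<open>auto simp: C_def\<close>)
    finally show ?thesis .
  qed
qed

theorem theorem1:
  "\<exists>A :: 'a algorithm. online_algorithm A \<and> competitive 3.869 A"
  using online_algorithm_algorithm competitive_algorithm by blast

end
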